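(* Let $K$ be a countable (infinite) field, let $(\Omega,\mathcal{B},\mu)$ be a probability space and let $(T_g)_{g\in\mathcal{A}_K}$ be an ergodic measure preserving action of $\mathcal{A}_K$ on $\Omega$. Let $(F_N)$ be a double F\o lner sequence in $K$. Then for any $B,C\in\mathcal{B}$, $$\lim_{N\to\infty}\frac1{|F_N|}\sum_{u\in F_N\setminus\{0\}}\mu\big(A_{-u}B\cap M_{1/u}C\big)=\mu(B)\mu(C),$$ and in particular the limit exists.
   Context: $\mathcal{A}_K$ is the affine group of $K$: the group of maps $x\mapsto ux+v$ ($u\in K^*=K\setminus\{0\}$, $v\in K$) under composition. For $u\in K^*$, $A_{-u}B:=T_gB$ where $g(x)=x-u$, and $M_{1/u}C:=T_hC$ where $h(x)=x/u$. A double F\o lner sequence in $K$ is a sequence $(F_N)$ of non-empty finite subsets of $K$ such that for each $x\in K^*$, $\lim_N|F_N\cap(F_N+x)|/|F_N|=\lim_N|F_N\cap(xF_N)|/|F_N|=1$. *)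

theory Defs
  imports "HOL-Probability.Probability" "HOL-Algebra.Group_Action"
begin

definition affine_map :: "'k::field \<Rightarrow> 'k \<Rightarrow> 'k \<Rightarrow> 'k" where
  "affine_map u v = (\<lambda>x. u * x + v)"

definition affine_group :: "('k::field \<Rightarrow> 'k) monoid" where
  "affine_group =
    \<lparr>carrier = {affine_map u v | u v. u \<noteq> 0}, mult = (\<circ>), one = id\<rparr>"

lemma affine_map_closed:
  "u \<noteq> 0 \<Longrightarrow> affine_map u v \<in> carrier affine_group"
  unfolding affine_group_def by auto

lemma group_affine_group: "group (affine_group :: ('k::field \<Rightarrow> 'k) monoid)"
proof (rule groupI)
  fix f g :: "'k \<Rightarrow> 'k"
  assume "f \<in> carrier affine_group" "g \<in> carrier affine_group"
  then obtain a b c d where fg: "f = affine_map a b" "a \<noteq> 0" "g = affine_map c d" "c \<noteq> 0"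
    by (auto simp: affine_group_def)
  have "f \<otimes>\<^bsub>affine_group\<^esub> g = affine_map (a * c) (a * d + b)"
    by (simp add: fg affine_group_def affine_map_def fun_eq_iff algebra_simps)
  with fg show "f \<otimes>\<^bsub>affine_group\<^esub> g \<in> carrier affine_group"
    by (simp add: affine_map_closed)
next
  have "\<one>\<^bsub>affine_group\<^esub> = affine_map 1 (0 :: 'k)"
    by (simp add: affine_group_def affine_map_def fun_eq_iff)
  then show "\<one>\<^bsub>affine_group\<^esub> \<in> carrier (affine_group :: ('k \<Rightarrow> 'k) monoid)"
    by (simp add: affine_map_closed)
next
  fix f :: "'k \<Rightarrow> 'k"
  assume "f \<in> carrier affine_group"
  then obtain a b where f: "f = affine_map a b" "a \<noteq> 0"
    by (auto simp: affine_group_def)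
  have "inverse a * (a * x + b) - inverse a * b = x" for x
    using f(2) by (simp add: distrib_left mult.assoc [symmetric])
  then have "affine_map (inverse a) (- (inverse a * b)) \<otimes>\<^bsub>affine_group\<^esub> f = \<one>\<^bsub>affine_group\<^esub>"
    by (simp add: f(1) affine_group_def affine_map_def fun_eq_iff)
  moreover have "affine_map (inverse a) (- (inverse a * b)) \<in> carrier affine_group"
    using f(2) by (simp add: affine_map_closed)
  ultimately show "\<exists>g\<in>carrier affine_group. g \<otimes>\<^bsub>affine_group\<^esub> f = \<one>\<^bsub>affine_group\<^esub>"
    by blast
qed (simp_all add: affine_group_def comp_assoc)

text \<open>
  The action is given by honest bijections of the underlying space, with the composition law
  holding everywhere. As \<^const>\<open>BijGroup\<close> consists of extensional functions, the maps
  are \<^const>\<open>undefined\<close> outside the space, which is irrelevant for sets in the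
  sigma-algebra.
\<close>

locale measure_preserving_action =
  group_action G "space M" T for G (structure) and M :: "'w measure" and T +
  assumes measurable_action: "g \<in> carrier G \<Longrightarrow> T g \<in> measurable M M"
    and emeasure_vimage_action:
      "g \<in> carrier G \<Longrightarrow> A \<in> sets M \<Longrightarrow> emeasure M (T g -` A \<inter> space M) = emeasure M A"

locale ergodic_action =
  measure_preserving_action G M T + prob_space M for G (structure) and M :: "'w measure" and T +
  assumes ergodic:
    "A \<in> sets M \<Longrightarrow> (\<And>g. g \<in> carrier G \<Longrightarrow> T g ` A = A) \<Longrightarrow> prob A = 0 \<or> prob A = 1"

definition double_folner :: "(nat \<Rightarrow> 'k::field set) \<Rightarrow> bool" where
  "double_folner F \<longleftrightarrow>
    (\<forall>N. finite (F N) \<and> F N \<noteq> {}) \<and>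
    (\<forall>x. x \<noteq> 0 \<longrightarrow>
      (\<lambda>N. real (card (F N \<inter> (\<lambda>y. y + x) ` F N)) / real (card (F N))) \<longlonglongrightarrow> 1 \<and>
      (\<lambda>N. real (card (F N \<inter> (\<lambda>y. x * y) ` F N)) / real (card (F N))) \<longlonglongrightarrow> 1)"

text \<open>
  \<open>shift_set T u B\<close> is $A_uB$ and \<open>dilate_set T u B\<close> is $M_uB$, where $A_u$ and $M_u$
  are the actions of $x \mapsto x + u$ and $x \mapsto ux$. Both are forward images.
\<close>

definition shift_set :: "(('k::field \<Rightarrow> 'k) \<Rightarrow> 'w \<Rightarrow> 'w) \<Rightarrow> 'k \<Rightarrow> 'w set \<Rightarrow> 'w set" where
  "shift_set T u B = T (affine_map 1 u) ` B"

definition dilate_set :: "(('k::field \<Rightarrow> 'k) \<Rightarrow> 'w \<Rightarrow> 'w) \<Rightarrow> 'k \<Rightarrow> 'w set \<Rightarrow> 'w set" where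
  "dilate_set T u B = T (affine_map u 0) ` B"

end

theory Submission
  imports Defs
begin

text \<open>
  After applying the dilation by \<open>u\<close>, the summand is the correlation of \<open>1\<^sub>C\<close> with
  \<open>1\<^sub>B\<close> composed with the action of \<open>x \<mapsto> x / u + u\<close>. Split \<open>1\<^sub>B = h + \<phi>\<close>, where \<open>h\<close> is the limit
  of the additive ergodic averages of \<open>1\<^sub>B\<close>. As \<open>h\<close> is translation invariant, only the dilation by
  \<open>1 / u\<close> acts on it; the multiplicative averages of \<open>h\<close> converge to a function that is invariant
  under the whole affine group (translations are normal), hence constant by ergodicity. For \<open>\<phi>\<close>,
  invariance under multiplicative shifts allows a van der Corput estimate: the correlation of the
  terms at \<open>d u\<close> and \<open>d' u\<close> is an additive correlation of \<open>\<phi>\<close> at \<open>c u\<close> with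
  \<open>c = (d\<^sup>2 - d'\<^sup>2) / d\<close>, which averages to zero over \<open>u\<close> as soon as \<open>d\<^sup>2 \<noteq> d'\<^sup>2\<close>.
\<close>

lemma tendsto_0_of_abs_le:
  fixes x y :: "nat \<Rightarrow> real"
  assumes "\<And>n. \<bar>x n\<bar> \<le> y n" "y \<longlonglongrightarrow> 0"
  shows "x \<longlonglongrightarrow> 0"
  using Lim_null_comparison[of x y sequentially] assms by simp

section \<open>Averages over finite index sets\<close>

definition average :: "'i set \<Rightarrow> ('i \<Rightarrow> real) \<Rightarrow> real" where
  "average A \<phi> = (\<Sum>u\<in>A. \<phi> u) / real (card A)"

lemma average_cong: "(\<And>u. u \<in> A \<Longrightarrow> f u = g u) \<Longrightarrow> average A f = average A g"
  by (simp add: average_def)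

lemma average_const [simp]: "finite A \<Longrightarrow> A \<noteq> {} \<Longrightarrow> average A (\<lambda>_. c) = c"
  by (simp add: average_def)

lemma average_add: "average A (\<lambda>u. f u + g u) = average A f + average A g"
  by (simp add: average_def sum.distrib add_divide_distrib)

lemma average_diff: "average A (\<lambda>u. f u - g u) = average A f - average A g"
  by (simp add: average_def sum_subtractf diff_divide_distrib)

lemma average_cmult: "average A (\<lambda>u. c * f u) = c * average A f"
  by (simp add: average_def sum_distrib_left)

lemma average_mono: "(\<And>u. u \<in> A \<Longrightarrow> f u \<le> g u) \<Longrightarrow> average A f \<le> average A g"
  by (simp add: average_def divide_right_mono sum_mono)

lemma average_abs_le: "\<bar>average A f\<bar> \<le> average A (\<lambda>u. \<bar>f u\<bar>)"
  by (simp add: average_def abs_divide divide_right_mono sum_abs)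

lemma average_bound:
  assumes "finite A" "A \<noteq> {}" "\<And>u. u \<in> A \<Longrightarrow> \<bar>f u\<bar> \<le> b"
  shows "\<bar>average A f\<bar> \<le> b"
  using average_abs_le[of A f] average_mono[of A "\<lambda>u. \<bar>f u\<bar>" "\<lambda>_. b"] assms by simp

lemma average_swap:
  "average A (\<lambda>u. average B (\<lambda>v. f u v)) = average B (\<lambda>v. average A (\<lambda>u. f u v))"
  by (simp add: average_def sum_divide_distrib[symmetric] sum.swap[of _ B A])

lemma average_power2: "(average A f)\<^sup>2 = average A (\<lambda>u. average A (\<lambda>v. f u * f v))"
proof -
  have "average A (\<lambda>u. average A (\<lambda>v. f u * f v)) = average A (\<lambda>u. average A f * f u)"
    by (simp add: average_cmult mult.commute)
  then show ?thesis by (simp only: average_cmult power2_eq_square)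
qed

text \<open>The empirical variance of \<open>f\<close> over \<open>A\<close> is nonnegative. For
  empty \<open>A\<close> both sides are zero, since division by zero yields zero.\<close>

lemma average_square_le: "finite A \<Longrightarrow> (average A f)\<^sup>2 \<le> average A (\<lambda>u. (f u)\<^sup>2)"
proof (cases "A = {}")
  case False
  assume A: "finite A"
  let ?m = "average A f"
  have "0 \<le> average A (\<lambda>u. (f u - ?m)\<^sup>2)"
    by (simp add: average_def sum_nonneg)
  also have "\<dots> = average A (\<lambda>u. (f u)\<^sup>2 - 2 * ?m * f u + ?m\<^sup>2)"
    by (simp add: power2_diff algebra_simps)
  also have "\<dots> = average A (\<lambda>u. (f u)\<^sup>2) - ?m\<^sup>2"
    using A False by (simp add: average_add average_diff average_cmult power2_eq_square)
  finally show ?thesis by simp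
qed (simp add: average_def)

text \<open>The ratio in the Folner condition, for an arbitrary self-map \<open>s\<close> of the
  index type, so that additive and multiplicative shifts can share the same estimates.\<close>

definition overlap :: "'i set \<Rightarrow> ('i \<Rightarrow> 'i) \<Rightarrow> real" where
  "overlap A s = real (card (A \<inter> s ` A)) / real (card A)"

text \<open>Reindexing turns the shifted sum into a sum over the image of \<open>A\<close>. The
  common part of \<open>A\<close> and its image cancels, and each of the two remaining pieces has as
  many elements as \<open>A\<close> loses in the overlap, each contributing at most
  \<open>b\<close>.\<close>

lemma average_shift:
  assumes A: "finite A" "A \<noteq> {}" and s: "inj_on s A"
    and b: "\<And>u. u \<in> A \<union> s ` A \<Longrightarrow> \<bar>\<phi> u\<bar> \<le> b"
  shows "\<bar>average A (\<lambda>u. \<phi> (s u)) - average A \<phi>\<bar> \<le> 2 * b * (1 - overlap A s)"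
proof -
  let ?I = "A \<inter> s ` A"
  have c: "card (A - ?I) = card A - card ?I" "card (s ` A - ?I) = card A - card ?I"
    using A s by (auto simp: card_Diff_subset card_image)
  have le: "card ?I \<le> card A" using A by (simp add: card_mono)
  have *: "\<bar>sum \<phi> B\<bar> \<le> real (card B) * b" if "B \<subseteq> A \<union> s ` A" for B
    by (rule sum_norm_bound[of B \<phi> b, unfolded real_norm_def]) (use b that in blast)
  have "(\<Sum>u\<in>A. \<phi> (s u)) - sum \<phi> A = sum \<phi> (s ` A) - sum \<phi> A"
    using s by (simp add: sum.reindex)
  also have "\<dots> = sum \<phi> (s ` A - ?I) - sum \<phi> (A - ?I)"
    using A by (simp add: sum_diff)
  also have "\<bar>\<dots>\<bar> \<le> 2 * b * (real (card A) - real (card ?I))"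
  proof -
    have "\<bar>sum \<phi> (s ` A - ?I)\<bar> \<le> (real (card A) - real (card ?I)) * b"
      using *[of "s ` A - ?I"] le by (simp add: c of_nat_diff le_supI2)
    moreover have "\<bar>sum \<phi> (A - ?I)\<bar> \<le> (real (card A) - real (card ?I)) * b"
      using *[of "A - ?I"] le by (simp add: c of_nat_diff le_supI1)
    ultimately show ?thesis by (simp add: algebra_simps)
  qed
  finally have "\<bar>(\<Sum>u\<in>A. \<phi> (s u)) - sum \<phi> A\<bar> / real (card A)
      \<le> 2 * b * (real (card A) - real (card ?I)) / real (card A)"
    by (rule divide_right_mono) simp
  moreover have "real (card A) > 0" using A by (simp add: card_gt_0_iff)
  ultimately show ?thesis
    by (simp add: average_def overlap_def diff_divide_distrib[symmetric] abs_divide)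
      (simp add: field_simps)
qed

section \<open>Bounded measurable functions and measure-preserving maps\<close>

definition bdd_meas :: "'w measure \<Rightarrow> real \<Rightarrow> ('w \<Rightarrow> real) \<Rightarrow> bool" where
  "bdd_meas M b f \<longleftrightarrow> f \<in> borel_measurable M \<and> (\<forall>w\<in>space M. \<bar>f w\<bar> \<le> b)"

text \<open>Invariance is phrased as equality of the pushforward measure, from which change of
  variables and the transport of almost-everywhere statements follow directly.\<close>

definition preserves :: "'w measure \<Rightarrow> ('w \<Rightarrow> 'w) \<Rightarrow> bool" where
  "preserves M S \<longleftrightarrow> S \<in> measurable M M \<and> distr M M S = M"

lemma preserves_measurable: "preserves M S \<Longrightarrow> S \<in> measurable M M"
  by (simp add: preserves_def)

lemma preserves_space: "preserves M S \<Longrightarrow> w \<in> space M \<Longrightarrow> S w \<in> space M"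
  by (meson measurable_space preserves_def)

lemma preserves_integral:
  assumes "preserves M S" "f \<in> borel_measurable M"
  shows "(\<integral>w. f (S w) \<partial>M) = (\<integral>w. (f w :: real) \<partial>M)"
  using integral_distr[of S M M f] assms by (simp add: preserves_def)

lemma preserves_AE: "preserves M S \<Longrightarrow> AE w in M. P w \<Longrightarrow> AE w in M. P (S w)"
  using AE_distrD[of S M M P] by (metis preserves_def)

lemma bdd_meas_measurable: "bdd_meas M b f \<Longrightarrow> f \<in> borel_measurable M"
  by (simp add: bdd_meas_def)

lemma bdd_meas_le: "bdd_meas M b f \<Longrightarrow> w \<in> space M \<Longrightarrow> \<bar>f w\<bar> \<le> b"
  by (simp add: bdd_meas_def)

lemma bdd_meas_comp: "bdd_meas M b f \<Longrightarrow> preserves M S \<Longrightarrow> bdd_meas M b (\<lambda>w. f (S w))"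
  unfolding bdd_meas_def
  by (auto dest: preserves_space intro: measurable_compose[OF preserves_measurable])

lemma bdd_meas_mult:
  assumes "bdd_meas M a f" "bdd_meas M b g"
  shows "bdd_meas M (a * b) (\<lambda>w. f w * g w)"
  using assms unfolding bdd_meas_def abs_mult by (auto intro!: mult_mono elim!: order_trans[rotated])

lemma bdd_meas_diff:
  assumes "bdd_meas M a f" "bdd_meas M b g"
  shows "bdd_meas M (a + b) (\<lambda>w. f w - g w)"
  using assms unfolding bdd_meas_def by (fastforce intro: order_trans[OF abs_triangle_ineq4])

lemma bdd_meas_midpoint:
  assumes "bdd_meas M b f" "bdd_meas M b g"
  shows "bdd_meas M b (\<lambda>w. (f w + g w) / 2)"
  using assms unfolding bdd_meas_def
  by (auto intro!: borel_measurable_divide borel_measurable_add) fastforce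

lemma bdd_meas_power2: "bdd_meas M a f \<Longrightarrow> bdd_meas M (a * a) (\<lambda>w. (f w)\<^sup>2)"
  by (simp add: bdd_meas_mult power2_eq_square)

lemma bdd_meas_abs: "bdd_meas M a f \<Longrightarrow> bdd_meas M a (\<lambda>w. \<bar>f w\<bar>)"
  unfolding bdd_meas_def by auto

lemma bdd_meas_average:
  assumes "finite A" "A \<noteq> {}" "\<And>u. u \<in> A \<Longrightarrow> bdd_meas M b (f u)"
  shows "bdd_meas M b (\<lambda>w. average A (\<lambda>u. f u w))"
  unfolding bdd_meas_def
proof (intro conjI ballI)
  show "(\<lambda>w. average A (\<lambda>u. f u w)) \<in> borel_measurable M"
    unfolding average_def
    by (intro borel_measurable_divide borel_measurable_sum)
      (use assms in \<open>auto simp: bdd_meas_def\<close>)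
qed (use assms in \<open>auto intro!: average_bound simp: bdd_meas_def\<close>)

section \<open>L1 and L2 estimates on a probability space\<close>

context prob_space
begin

lemma bdd_meas_nonneg: "bdd_meas M b f \<Longrightarrow> 0 \<le> b"
  using not_empty by (force simp: bdd_meas_def)

lemma bdd_meas_integrable: "bdd_meas M b f \<Longrightarrow> integrable M f"
  by (rule integrable_const_bound[where B = b]) (auto simp: bdd_meas_def)

lemma integral_average:
  assumes "\<And>u. u \<in> A \<Longrightarrow> bdd_meas M b (f u)"
  shows "(\<integral>w. average A (\<lambda>u. f u w) \<partial>M) = average A (\<lambda>u. \<integral>w. f u w \<partial>M)"
  unfolding average_def
  by (subst integral_divide_zero, subst Bochner_Integration.integral_sum)
    (use assms bdd_meas_integrable in auto)

text \<open>The variance of the absolute value of \<open>f\<close> is nonnegative. This is the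
  passage from L2 estimates to the L1 statements in which all limits are expressed.\<close>

lemma L1_square_le:
  assumes "bdd_meas M b f"
  shows "(\<integral>w. \<bar>f w\<bar> \<partial>M)\<^sup>2 \<le> (\<integral>w. (f w)\<^sup>2 \<partial>M)"
proof -
  have "0 \<le> variance (\<lambda>w. \<bar>f w\<bar>)" by simp
  also have "\<dots> = (\<integral>w. (f w)\<^sup>2 \<partial>M) - (\<integral>w. \<bar>f w\<bar> \<partial>M)\<^sup>2"
    using assms
    by (subst variance_eq)
      (auto intro: bdd_meas_integrable bdd_meas_abs bdd_meas_power2)
  finally show ?thesis by simp
qed

lemma integral_mult_le_L1:
  assumes f: "bdd_meas M a f" and g: "bdd_meas M b g"
  shows "\<bar>\<integral>w. f w * g w \<partial>M\<bar> \<le> b * (\<integral>w. \<bar>f w\<bar> \<partial>M)"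
proof -
  have "\<bar>\<integral>w. f w * g w \<partial>M\<bar> \<le> (\<integral>w. \<bar>f w * g w\<bar> \<partial>M)"
    by (rule integral_abs_bound)
  also have "\<dots> \<le> (\<integral>w. b * \<bar>f w\<bar> \<partial>M)"
  proof (rule integral_mono)
    show "integrable M (\<lambda>w. b * \<bar>f w\<bar>)" by (intro integrable_mult_right bdd_meas_integrable[OF bdd_meas_abs[OF f]])
    show "\<bar>f w * g w\<bar> \<le> b * \<bar>f w\<bar>" if "w \<in> space M" for w
      using mult_right_mono[OF bdd_meas_le[OF g that], of "\<bar>f w\<bar>"] by (simp add: abs_mult mult.commute)
  qed (rule bdd_meas_integrable[OF bdd_meas_abs[OF bdd_meas_mult[OF f g]]])
  finally show ?thesis by simp
qed

lemma L1_triangle: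
  assumes "bdd_meas M a f" "bdd_meas M b g" "bdd_meas M c h"
  shows "(\<integral>w. \<bar>f w - h w\<bar> \<partial>M) \<le> (\<integral>w. \<bar>f w - g w\<bar> \<partial>M) + (\<integral>w. \<bar>g w - h w\<bar> \<partial>M)"
proof -
  note int = bdd_meas_integrable[OF bdd_meas_abs[OF bdd_meas_diff]]
  have "(\<integral>w. \<bar>f w - h w\<bar> \<partial>M) \<le> (\<integral>w. \<bar>f w - g w\<bar> + \<bar>g w - h w\<bar> \<partial>M)"
    by (rule integral_mono)
      (rule Bochner_Integration.integrable_add int assms | linarith)+
  also have "\<dots> = (\<integral>w. \<bar>f w - g w\<bar> \<partial>M) + (\<integral>w. \<bar>g w - h w\<bar> \<partial>M)"
    by (rule Bochner_Integration.integral_add) (rule int assms)+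
  finally show ?thesis .
qed

lemma L1_uniform_le:
  assumes "bdd_meas M a f" "bdd_meas M b g" "\<And>w. w \<in> space M \<Longrightarrow> \<bar>f w - g w\<bar> \<le> e"
  shows "(\<integral>w. \<bar>f w - g w\<bar> \<partial>M) \<le> e"
proof -
  have "(\<integral>w. \<bar>f w - g w\<bar> \<partial>M) \<le> (\<integral>w. e \<partial>M)"
    by (rule integral_mono) 
      (use assms bdd_meas_integrable[OF bdd_meas_abs[OF bdd_meas_diff]] in auto)
  then show ?thesis by (simp add: prob_space)
qed

lemma L1_zero_imp_AE:
  assumes "bdd_meas M a f" "(\<integral>w. \<bar>f w\<bar> \<partial>M) \<le> 0"
  shows "AE w in M. f w = 0"
proof -
  have "(\<integral>w. \<bar>f w\<bar> \<partial>M) = 0" using assms(2) by (intro antisym) simp_all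
  then show ?thesis
    using integral_nonneg_eq_0_iff_AE[of M "\<lambda>w. \<bar>f w\<bar>"] bdd_meas_integrable[OF bdd_meas_abs[OF assms(1)]]
    by auto
qed

text \<open>Go from \<open>h\<close> composed with \<open>P\<close> to \<open>h\<close> through
  \<open>X n\<close> composed with \<open>P\<close> and \<open>X n\<close>. The two outer distances
  agree because \<open>P\<close> preserves the measure, and the middle one is at most
  \<open>e n\<close>; all of them vanish in the limit.\<close>

lemma L1_limit_invariant:
  assumes X: "\<And>n. bdd_meas M b (X n)" and h: "bdd_meas M c h" and P: "preserves M P"
    and lim: "(\<lambda>n. \<integral>w. \<bar>X n w - h w\<bar> \<partial>M) \<longlonglongrightarrow> 0"
    and inv: "\<And>n. (\<integral>w. \<bar>X n (P w) - X n w\<bar> \<partial>M) \<le> e n" "e \<longlonglongrightarrow> 0"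
  shows "AE w in M. h (P w) = h w"
proof -
  have "(\<integral>w. \<bar>h (P w) - h w\<bar> \<partial>M) \<le> 2 * (\<integral>w. \<bar>X n w - h w\<bar> \<partial>M) + e n" for n
  proof -
    have "(\<integral>w. \<bar>h (P w) - h w\<bar> \<partial>M)
       \<le> (\<integral>w. \<bar>h (P w) - X n (P w)\<bar> \<partial>M) + (\<integral>w. \<bar>X n (P w) - h w\<bar> \<partial>M)"
      by (rule L1_triangle[OF bdd_meas_comp[OF h P] bdd_meas_comp[OF X P] h])
    moreover have "(\<integral>w. \<bar>X n (P w) - h w\<bar> \<partial>M)
       \<le> (\<integral>w. \<bar>X n (P w) - X n w\<bar> \<partial>M) + (\<integral>w. \<bar>X n w - h w\<bar> \<partial>M)"
      by (rule L1_triangle[OF bdd_meas_comp[OF X P] X h])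
    moreover have "(\<integral>w. \<bar>h (P w) - X n (P w)\<bar> \<partial>M) = (\<integral>w. \<bar>X n w - h w\<bar> \<partial>M)"
      using preserves_integral[OF P bdd_meas_measurable[OF bdd_meas_abs[OF bdd_meas_diff[OF h X]]]]
      by (simp add: abs_minus_commute)
    ultimately show ?thesis using inv(1)[of n] by linarith
  qed
  moreover have "(\<lambda>n. 2 * (\<integral>w. \<bar>X n w - h w\<bar> \<partial>M) + e n) \<longlonglongrightarrow> 0"
    by (rule tendsto_eq_rhs, (rule tendsto_add tendsto_mult tendsto_const lim inv)+) simp
  ultimately have "(\<integral>w. \<bar>h (P w) - h w\<bar> \<partial>M) \<le> 0"
    by (intro LIMSEQ_le_const) auto
  then show ?thesis
    using L1_zero_imp_AE[OF bdd_meas_diff[OF bdd_meas_comp[OF h P] h]] by simp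
qed

text \<open>An L2 Cauchy sequence is L1 Cauchy, so a subsequence converges almost everywhere.
  Dominated convergence makes the subsequence converge in L1, and the Cauchy property extends this
  to the whole sequence.\<close>

lemma L2_Cauchy_limit:
  assumes X: "\<And>n. bdd_meas M b (X n)"
    and cau: "\<And>e. 0 < e \<Longrightarrow> \<exists>N. \<forall>m\<ge>N. \<forall>n\<ge>N. (\<integral>w. (X m w - X n w)\<^sup>2 \<partial>M) < e"
  obtains h where "bdd_meas M b h" "(\<lambda>n. \<integral>w. \<bar>X n w - h w\<bar> \<partial>M) \<longlonglongrightarrow> 0"
proof -
  have b: "0 \<le> b" using X bdd_meas_nonneg by blast
  have [measurable]: "X n \<in> borel_measurable M" for n using X by (rule bdd_meas_measurable)
  have L1: "\<exists>N. \<forall>m\<ge>N. \<forall>n\<ge>N. (\<integral>w. \<bar>X m w - X n w\<bar> \<partial>M) < e" if e: "0 < e" for e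
  proof -
    obtain N where N: "\<And>m n. m \<ge> N \<Longrightarrow> n \<ge> N \<Longrightarrow> (\<integral>w. (X m w - X n w)\<^sup>2 \<partial>M) < e\<^sup>2"
      using cau[of "e\<^sup>2"] e by auto
    have "(\<integral>w. \<bar>X m w - X n w\<bar> \<partial>M) < e" if "m \<ge> N" "n \<ge> N" for m n
      using L1_square_le[OF bdd_meas_diff[OF X X], of m n] N[OF that] e
      by (intro power2_less_imp_less[of _ e]) auto
    then show ?thesis by blast
  qed
  obtain r where r: "strict_mono r" "AE w in M. Cauchy (\<lambda>i. X (r i) w)"
    using cauchy_L1_AE_cauchy_subseq[of M X] L1 bdd_meas_integrable[OF X] by auto
  \<comment> \<open>Clamping to the interval from \<open>-b\<close> to \<open>b\<close> makes the
    bound hold everywhere, also at points where the subsequence diverges and \<open>lim\<close> is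
    arbitrary. At points of convergence it changes nothing.\<close>
  define h where "h w = max (- b) (min b (lim (\<lambda>i. X (r i) w)))" for w
  have [measurable]: "h \<in> borel_measurable M" unfolding h_def by measurable
  have h: "bdd_meas M b h" using b by (auto simp: bdd_meas_def h_def)
  have lim: "AE w in M. (\<lambda>i. \<bar>X m w - X (r i) w\<bar>) \<longlonglongrightarrow> \<bar>X m w - h w\<bar>" for m
    using r(2) AE_space
  proof eventually_elim
    case (elim w)
    then have l: "(\<lambda>i. X (r i) w) \<longlonglongrightarrow> lim (\<lambda>i. X (r i) w)"
      by (simp add: Cauchy_convergent_iff convergent_LIMSEQ_iff)
    have bd: "- b \<le> X n w \<and> X n w \<le> b" for n
      using bdd_meas_le[OF X elim(2), of n] by linarith
    have "lim (\<lambda>i. X (r i) w) \<le> b" by (rule LIMSEQ_le_const2[OF l]) (use bd in blast)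
    moreover have "-b \<le> lim (\<lambda>i. X (r i) w)" by (rule LIMSEQ_le_const[OF l]) (use bd in blast)
    ultimately have "h w = lim (\<lambda>i. X (r i) w)" by (simp add: h_def)
    then show ?case using l by (intro tendsto_intros) simp
  qed
  \<comment> \<open>With \<open>m\<close> fixed, this turns a bound on the distances from
    \<open>X m\<close> to the subsequence into a bound on the distance from \<open>X m\<close> to
    \<open>h\<close>.\<close>
  have conv: "(\<lambda>i. \<integral>w. \<bar>X m w - X (r i) w\<bar> \<partial>M) \<longlonglongrightarrow> (\<integral>w. \<bar>X m w - h w\<bar> \<partial>M)" for m
  proof (rule integral_dominated_convergence[OF _ _ _ lim])
    show "integrable M (\<lambda>_. b + b)" by simp
    show "AE w in M. norm \<bar>X m w - X (r i) w\<bar> \<le> b + b" for i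
      using bdd_meas_le[OF bdd_meas_diff[OF X X]] by (intro AE_I2) simp
  qed simp_all
  have "\<exists>N. \<forall>m\<ge>N. (\<integral>w. \<bar>X m w - h w\<bar> \<partial>M) < e" if e: "0 < e" for e
  proof -
    obtain N where N: "\<And>m n. m \<ge> N \<Longrightarrow> n \<ge> N \<Longrightarrow> (\<integral>w. \<bar>X m w - X n w\<bar> \<partial>M) < e / 2"
      using L1[of "e / 2"] e by auto
    have "(\<integral>w. \<bar>X m w - h w\<bar> \<partial>M) \<le> e / 2" if m: "m \<ge> N" for m
    proof (rule LIMSEQ_le_const2[OF conv], intro exI allI impI)
      fix i assume "N \<le> i"
      then have "N \<le> r i" using seq_suble[OF r(1), of i] by linarith
      then show "(\<integral>w. \<bar>X m w - X (r i) w\<bar> \<partial>M) \<le> e / 2" using N[OF m] by fastforce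
    qed
    then show ?thesis using e by (intro exI[of _ N]) fastforce
  qed
  then have "(\<lambda>n. \<integral>w. \<bar>X n w - h w\<bar> \<partial>M) \<longlonglongrightarrow> 0"
    by (intro LIMSEQ_I) simp
  with h show ?thesis by (rule that)
qed

end

section \<open>The mean ergodic theorem\<close>

text \<open>A common frame for two commutative actions: the additive group of the field acting by
  translations and its multiplicative group acting by dilations, both averaged over the same sets
  \<open>F N\<close>.\<close>

locale folner_system = prob_space M for M :: "'w measure" +
  fixes I :: "'i set" and mul :: "'i \<Rightarrow> 'i \<Rightarrow> 'i" and S :: "'i \<Rightarrow> 'w \<Rightarrow> 'w"
    and F :: "nat \<Rightarrow> 'i set"
  assumes pres: "i \<in> I \<Longrightarrow> preserves M (S i)"
    and commute: "i \<in> I \<Longrightarrow> j \<in> I \<Longrightarrow> mul i j = mul j i"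
    and inj: "i \<in> I \<Longrightarrow> inj_on (mul i) I"
    and closed: "i \<in> I \<Longrightarrow> j \<in> I \<Longrightarrow> mul i j \<in> I"
    and act: "i \<in> I \<Longrightarrow> j \<in> I \<Longrightarrow> w \<in> space M \<Longrightarrow> S (mul i j) w = S i (S j w)"
    and fin: "finite (F N)" and ne: "F N \<noteq> {}" and sub: "F N \<subseteq> I"
    and folner: "i \<in> I \<Longrightarrow> (\<lambda>N. overlap (F N) (mul i)) \<longlonglongrightarrow> 1"
begin

definition erg :: "('w \<Rightarrow> real) \<Rightarrow> nat \<Rightarrow> 'w \<Rightarrow> real" where
  "erg f N w = average (F N) (\<lambda>u. f (S u w))"

lemma mem: "u \<in> F N \<Longrightarrow> u \<in> I"
  using sub by blast

lemma bdd_meas_erg: "bdd_meas M b f \<Longrightarrow> bdd_meas M b (erg f N)"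
  unfolding erg_def by (rule bdd_meas_average[OF fin ne bdd_meas_comp[OF _ pres[OF mem]]])

lemma erg_shift:
  assumes f: "bdd_meas M b f" and v: "v \<in> I" and w: "w \<in> space M"
  shows "\<bar>average (F N) (\<lambda>u. f (S (mul v u) w)) - erg f N w\<bar> \<le> 2 * b * (1 - overlap (F N) (mul v))"
  unfolding erg_def
proof (rule average_shift[OF fin ne])
  show "inj_on (mul v) (F N)" using inj[OF v] sub by (rule inj_on_subset)
  fix u assume "u \<in> F N \<union> mul v ` F N"
  then have "u \<in> I" using sub v closed by blast
  then show "\<bar>f (S u w)\<bar> \<le> b" by (intro bdd_meas_le[OF f] preserves_space[OF pres] w)
qed

lemma shift_error_tendsto_0:
  assumes "v \<in> I"
  shows "(\<lambda>N. 2 * b * (1 - overlap (F N) (mul v))) \<longlonglongrightarrow> 0"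
  by (rule tendsto_eq_rhs, (rule tendsto_intros folner assms)+) simp

text \<open>Moving the point by \<open>S v\<close> multiplies the index by \<open>v\<close> on the
  right. Commutativity turns this into a left multiplication, to which the Folner estimate
  applies.\<close>

lemma erg_invariant:
  assumes f: "bdd_meas M b f" and v: "v \<in> I" and w: "w \<in> space M"
  shows "\<bar>erg f N (S v w) - erg f N w\<bar> \<le> 2 * b * (1 - overlap (F N) (mul v))"
proof -
  have "erg f N (S v w) = average (F N) (\<lambda>u. f (S (mul v u) w))"
    unfolding erg_def
    by (intro average_cong) (simp add: commute[OF v mem] act[OF mem v w])
  then show ?thesis using erg_shift[OF f v w] by simp
qed

text \<open>The Folner defect of \<open>F L\<close>, averaged over the shifts in \<open>F N\<close>:
  the price of replacing an iterated average by the outer one. For fixed \<open>N\<close> it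
  vanishes as \<open>L\<close> grows.\<close>

definition err :: "real \<Rightarrow> nat \<Rightarrow> nat \<Rightarrow> real" where
  "err b N L = average (F N) (\<lambda>v. 2 * b * (1 - overlap (F L) (mul v)))"

lemma err_tendsto_0: "(\<lambda>L. err b N L) \<longlonglongrightarrow> 0"
proof -
  have "(\<lambda>L. err b N L) \<longlonglongrightarrow> (\<Sum>v\<in>F N. 0) / real (card (F N))"
    unfolding err_def average_def
    using ne fin
    by (intro tendsto_divide tendsto_sum shift_error_tendsto_0 mem tendsto_const) auto
  then show ?thesis by simp
qed

text \<open>After interchanging the two averages, the inner one is an average over
  \<open>F L\<close> shifted by an element \<open>v\<close> of \<open>F N\<close>, which differs
  from the unshifted one by at most the defect at \<open>v\<close>.\<close>

lemma erg_erg: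
  assumes f: "bdd_meas M b f" and w: "w \<in> space M"
  shows "\<bar>erg (erg f N) L w - erg f L w\<bar> \<le> err b N L"
proof -
  have "erg (erg f N) L w = average (F N) (\<lambda>v. average (F L) (\<lambda>u. f (S v (S u w))))"
    unfolding erg_def by (rule average_swap)
  also have "\<dots> = average (F N) (\<lambda>v. average (F L) (\<lambda>u. f (S (mul v u) w)))"
    by (intro average_cong) (simp add: act mem w)
  finally have "erg (erg f N) L w - erg f L w
      = average (F N) (\<lambda>v. average (F L) (\<lambda>u. f (S (mul v u) w)) - erg f L w)"
    by (simp add: average_diff fin ne)
  also have "\<bar>\<dots>\<bar> \<le> average (F N) (\<lambda>v. \<bar>average (F L) (\<lambda>u. f (S (mul v u) w)) - erg f L w\<bar>)"
    by (rule average_abs_le)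
  also have "\<dots> \<le> err b N L"
    unfolding err_def by (intro average_mono erg_shift f w mem)
  finally show ?thesis .
qed

text \<open>Pointwise, the square of an average is at most the average of the squares; by invariance
  of the measure each of these squares has the same integral as that of \<open>Z\<close>.\<close>

lemma erg_contraction:
  assumes Z: "bdd_meas M b Z"
  shows "(\<integral>w. (erg Z L w)\<^sup>2 \<partial>M) \<le> (\<integral>w. (Z w)\<^sup>2 \<partial>M)"
proof -
  have b: "bdd_meas M (b * b) (\<lambda>w. (Z (S u w))\<^sup>2)" if "u \<in> F L" for u
    by (rule bdd_meas_power2[OF bdd_meas_comp[OF Z pres[OF mem[OF that]]]])
  have "(\<integral>w. (erg Z L w)\<^sup>2 \<partial>M) \<le> (\<integral>w. average (F L) (\<lambda>u. (Z (S u w))\<^sup>2) \<partial>M)"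
  proof (rule integral_mono)
    show "integrable M (\<lambda>w. (erg Z L w)\<^sup>2)"
      by (rule bdd_meas_integrable[OF bdd_meas_power2[OF bdd_meas_erg[OF Z]]])
    show "integrable M (\<lambda>w. average (F L) (\<lambda>u. (Z (S u w))\<^sup>2))"
      by (rule bdd_meas_integrable[OF bdd_meas_average[OF fin ne b]])
  qed (simp add: erg_def average_square_le fin)
  also have "\<dots> = average (F L) (\<lambda>u. \<integral>w. (Z (S u w))\<^sup>2 \<partial>M)"
    by (rule integral_average[OF b])
  also have "\<dots> = average (F L) (\<lambda>u. \<integral>w. (Z w)\<^sup>2 \<partial>M)"
    using bdd_meas_measurable[OF bdd_meas_power2[OF Z]]
    by (intro average_cong preserves_integral[OF pres[OF mem], where f = "\<lambda>w. (Z w)\<^sup>2"])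
  also have "\<dots> = (\<integral>w. (Z w)\<^sup>2 \<partial>M)" by (simp add: fin ne)
  finally show ?thesis .
qed

text \<open>Averaging the midpoint of \<open>erg f m\<close> and \<open>erg f n\<close> over
  \<open>F L\<close> gives \<open>erg f L\<close> up to a uniform error and does not increase the L2
  norm. The difference of the squares is factored into difference and sum; the sum is at most
  \<open>2 * b\<close>, which leads to the factor \<open>b\<close> in front of the errors.\<close>

lemma erg_norm_le:
  assumes f: "bdd_meas M b f"
  shows "(\<integral>w. (erg f L w)\<^sup>2 \<partial>M)
    \<le> (\<integral>w. ((erg f m w + erg f n w) / 2)\<^sup>2 \<partial>M) + b * (err b m L + err b n L)"
proof -
  let ?Z = "\<lambda>w. (erg f m w + erg f n w) / 2"
  have Z: "bdd_meas M b ?Z"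
    by (rule bdd_meas_midpoint[OF bdd_meas_erg[OF f] bdd_meas_erg[OF f]])
  have i1: "integrable M (\<lambda>w. (erg f L w)\<^sup>2)"
    by (rule bdd_meas_integrable[OF bdd_meas_power2[OF bdd_meas_erg[OF f]]])
  have i2: "integrable M (\<lambda>w. (erg ?Z L w)\<^sup>2)"
    by (rule bdd_meas_integrable[OF bdd_meas_power2[OF bdd_meas_erg[OF Z]]])
  have "(\<integral>w. (erg f L w)\<^sup>2 \<partial>M) \<le> (\<integral>w. (erg ?Z L w)\<^sup>2 + b * (err b m L + err b n L) \<partial>M)"
  proof (rule integral_mono[OF i1 Bochner_Integration.integrable_add[OF i2]])
    fix w assume w: "w \<in> space M"
    let ?x = "erg f L w" and ?y = "erg ?Z L w"
    have y: "?y = (erg (erg f m) L w + erg (erg f n) L w) / 2"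
      unfolding erg_def average_add[symmetric]
      by (simp add: average_def sum_divide_distrib add_divide_distrib sum.distrib mult_ac)
    have d: "\<bar>?x - ?y\<bar> \<le> (err b m L + err b n L) / 2"
      unfolding y using erg_erg[OF f w, of m L] erg_erg[OF f w, of n L] by (simp add: field_simps)
    have "?x\<^sup>2 - ?y\<^sup>2 = (?x - ?y) * (?x + ?y)"
      by (simp add: power2_eq_square algebra_simps)
    also have "\<dots> \<le> \<bar>?x - ?y\<bar> * \<bar>?x + ?y\<bar>"
      by (simp only: abs_ge_self flip: abs_mult)
    also have "\<dots> \<le> ((err b m L + err b n L) / 2) * (2 * b)"
    proof (rule mult_mono[OF d])
      show "\<bar>?x + ?y\<bar> \<le> 2 * b"
        using bdd_meas_le[OF bdd_meas_erg[OF f] w, of L] bdd_meas_le[OF bdd_meas_erg[OF Z] w, of L]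
        by linarith
    qed (use d in linarith)+
    finally have "?x\<^sup>2 - ?y\<^sup>2 \<le> b * (err b m L + err b n L)" by (simp add: mult.commute)
    then show "?x\<^sup>2 \<le> ?y\<^sup>2 + b * (err b m L + err b n L)" by linarith
  qed simp
  also have "\<dots> = (\<integral>w. (erg ?Z L w)\<^sup>2 \<partial>M) + b * (err b m L + err b n L)"
    using i2 by (simp add: prob_space)
  also have "\<dots> \<le> (\<integral>w. (?Z w)\<^sup>2 \<partial>M) + b * (err b m L + err b n L)"
    using erg_contraction[OF Z] by simp
  finally show ?thesis .
qed

text \<open>
  The squared norms of the averages converge to their infimum, and asymptotically no midpoint
  of two averages has smaller norm; hence the parallelogram law makes the averages Cauchy.
\<close>

lemma erg_L2_Cauchy:
  assumes f: "bdd_meas M b f" and e: "0 < e"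
  shows "\<exists>N. \<forall>m\<ge>N. \<forall>n\<ge>N. (\<integral>w. (erg f m w - erg f n w)\<^sup>2 \<partial>M) < e"
proof -
  define q where "q n = (\<integral>w. (erg f n w)\<^sup>2 \<partial>M)" for n
  define c where "c = (INF n. q n)"
  have bdd: "bdd_below (range q)" by (rule bdd_belowI[of _ 0]) (auto simp: q_def)
  have c_le: "c \<le> q n" for n unfolding c_def by (rule cINF_lower[OF bdd]) simp
  have lim: "(\<lambda>L. A + b * (err b m L + err b n L)) \<longlonglongrightarrow> A" for A m n
    by (rule tendsto_eq_rhs, (rule tendsto_intros err_tendsto_0)+) simp
  have mid: "c \<le> (\<integral>w. ((erg f m w + erg f n w) / 2)\<^sup>2 \<partial>M)" for m n
    using erg_norm_le[OF f, of _ m n] c_le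
    by (intro LIMSEQ_le_const[OF lim[of _ m n]]) (auto simp: q_def intro: order_trans)
  \<comment> \<open>Two squared norms below \<open>c + e / 8\<close> and a midpoint of squared norm
    at least \<open>c\<close> give, by the parallelogram law, a squared distance below
    \<open>4 * (c + e / 8) - 4 * c = e / 2\<close>.\<close>
  obtain n0 where n0: "q n0 < c + e / 8"
    using cINF_less_iff[OF _ bdd, of "c + e / 8"] e unfolding c_def by auto
  have "\<forall>\<^sub>F L in sequentially. q n0 + b * (err b n0 L + err b n0 L) < c + e / 8"
    using order_tendstoD(2)[OF lim n0] .
  then obtain N where N: "\<And>L. L \<ge> N \<Longrightarrow> q n0 + b * (err b n0 L + err b n0 L) < c + e / 8"
    by (auto simp: eventually_sequentially)
  \<comment> \<open>For \<open>m = n = n0\<close> the midpoint is \<open>erg f n0\<close> itself, so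
    near-minimality of this one average passes to all sufficiently late ones.\<close>
  have q: "q L < c + e / 8" if "L \<ge> N" for L
    using erg_norm_le[OF f, of L n0 n0] N[OF that] by (simp add: q_def)
  have "(\<integral>w. (erg f m w - erg f n w)\<^sup>2 \<partial>M) < e" if mn: "m \<ge> N" "n \<ge> N" for m n
  proof -
    note int = bdd_meas_integrable[OF bdd_meas_power2[OF bdd_meas_erg[OF f]]]
    have "integrable M (\<lambda>w. ((erg f m w + erg f n w) / 2)\<^sup>2)"
      by (rule bdd_meas_integrable[OF bdd_meas_power2[OF
            bdd_meas_midpoint[OF bdd_meas_erg[OF f] bdd_meas_erg[OF f]]]])
    moreover have "(\<integral>w. (erg f m w - erg f n w)\<^sup>2 \<partial>M)
       = (\<integral>w. 2 * (erg f m w)\<^sup>2 + 2 * (erg f n w)\<^sup>2 - 4 * ((erg f m w + erg f n w) / 2)\<^sup>2 \<partial>M)"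
      by (intro Bochner_Integration.integral_cong) (auto simp: power2_eq_square field_simps)
    ultimately have "(\<integral>w. (erg f m w - erg f n w)\<^sup>2 \<partial>M)
       = 2 * q m + 2 * q n - 4 * (\<integral>w. ((erg f m w + erg f n w) / 2)\<^sup>2 \<partial>M)"
      using int[of m] int[of n] by (simp add: q_def)
    then show ?thesis using q[OF mn(1)] q[OF mn(2)] mid[of m n] e by linarith
  qed
  then show ?thesis by blast
qed

text \<open>The last clause characterises \<open>h\<close> as the conditional expectation of
  \<open>f\<close> on the invariant functions, without Hilbert space projections. Integration
  against an invariant \<open>q\<close> does not distinguish \<open>f\<close> from its averages, and
  this survives the L1 limit because \<open>q\<close> is bounded.\<close>

theorem mean_ergodic:
  assumes f: "bdd_meas M b f"
  obtains h where "bdd_meas M b h" "(\<lambda>N. \<integral>w. \<bar>erg f N w - h w\<bar> \<partial>M) \<longlonglongrightarrow> 0"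
    "\<And>v. v \<in> I \<Longrightarrow> AE w in M. h (S v w) = h w"
    "\<And>a q. bdd_meas M a q \<Longrightarrow> (\<And>v. v \<in> I \<Longrightarrow> AE w in M. q (S v w) = q w) \<Longrightarrow>
      (\<integral>w. h w * q w \<partial>M) = (\<integral>w. f w * q w \<partial>M)"
proof -
  obtain h where h: "bdd_meas M b h" and lim: "(\<lambda>N. \<integral>w. \<bar>erg f N w - h w\<bar> \<partial>M) \<longlonglongrightarrow> 0"
    using L2_Cauchy_limit[of b "erg f"] bdd_meas_erg[OF f] erg_L2_Cauchy[OF f] by blast
  note erg = bdd_meas_erg[OF f]
  have inv: "AE w in M. h (S v w) = h w" if v: "v \<in> I" for v
  proof (rule L1_limit_invariant[OF erg h pres[OF v] lim _ shift_error_tendsto_0[OF v]])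
    show "(\<integral>w. \<bar>erg f N (S v w) - erg f N w\<bar> \<partial>M) \<le> 2 * b * (1 - overlap (F N) (mul v))" for N
      by (rule L1_uniform_le[OF bdd_meas_comp[OF erg pres[OF v]] erg]) (rule erg_invariant[OF f v])
  qed
  have eq: "(\<integral>w. h w * q w \<partial>M) = (\<integral>w. f w * q w \<partial>M)"
    if q: "bdd_meas M a q" and qi: "\<And>v. v \<in> I \<Longrightarrow> AE w in M. q (S v w) = q w" for a q
  proof -
    have e: "(\<integral>w. erg f N w * q w \<partial>M) = (\<integral>w. f w * q w \<partial>M)" for N
    proof -
      have "(\<integral>w. erg f N w * q w \<partial>M) = (\<integral>w. average (F N) (\<lambda>u. f (S u w) * q w) \<partial>M)"
        by (simp add: erg_def average_def sum_distrib_right)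
      also have "\<dots> = average (F N) (\<lambda>u. \<integral>w. f (S u w) * q w \<partial>M)"
        by (rule integral_average[OF bdd_meas_mult[OF bdd_meas_comp[OF f pres[OF mem]] q]])
      also have "\<dots> = average (F N) (\<lambda>u. \<integral>w. f w * q w \<partial>M)"
      proof (rule average_cong)
        fix u assume u: "u \<in> F N"
        note P = pres[OF mem[OF u]]
        \<comment> \<open>Invariance of \<open>q\<close> lets the shift be inserted in the second
          factor as well; the whole product is then a composition with \<open>S u\<close>.\<close>
        have "(\<integral>w. f (S u w) * q w \<partial>M) = (\<integral>w. f (S u w) * q (S u w) \<partial>M)"
          by (rule integral_cong_AE)
            (use qi[OF mem[OF u]] bdd_meas_measurable[OF bdd_meas_mult[OF bdd_meas_comp[OF f P] q]]
              bdd_meas_measurable[OF bdd_meas_mult[OF bdd_meas_comp[OF f P] bdd_meas_comp[OF q P]]]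
              in auto)
        also have "\<dots> = (\<integral>w. f w * q w \<partial>M)"
          using preserves_integral[OF P bdd_meas_measurable[OF bdd_meas_mult[OF f q]]] .
        finally show "(\<integral>w. f (S u w) * q w \<partial>M) = (\<integral>w. f w * q w \<partial>M)" .
      qed
      finally show ?thesis by (simp add: fin ne)
    qed
    have "\<bar>(\<integral>w. f w * q w \<partial>M) - (\<integral>w. h w * q w \<partial>M)\<bar> \<le> a * (\<integral>w. \<bar>erg f N w - h w\<bar> \<partial>M)" for N
    proof -
      have "(\<integral>w. f w * q w \<partial>M) - (\<integral>w. h w * q w \<partial>M) = (\<integral>w. (erg f N w - h w) * q w \<partial>M)"
        using bdd_meas_integrable[OF bdd_meas_mult[OF erg q]] bdd_meas_integrable[OF bdd_meas_mult[OF h q]]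
        by (simp add: e[symmetric, of N] left_diff_distrib)
      then show ?thesis using integral_mult_le_L1[OF bdd_meas_diff[OF erg h] q] by simp
    qed
    moreover have "(\<lambda>N. a * (\<integral>w. \<bar>erg f N w - h w\<bar> \<partial>M)) \<longlonglongrightarrow> 0"
      using tendsto_mult_left[OF lim] by simp
    ultimately have "\<bar>(\<integral>w. f w * q w \<partial>M) - (\<integral>w. h w * q w \<partial>M)\<bar> \<le> 0"
      by (intro LIMSEQ_le_const) auto
    then show ?thesis by simp
  qed
  show ?thesis by (rule that[OF h lim inv eq])
qed

end

section \<open>The action of the affine group\<close>

text \<open>The fibres of squaring have at most two elements, so there are infinitely many nonzero
  squares; choose one root for each of \<open>n\<close> of them. This holds in every characteristic.
  The resulting set supplies the multipliers of the van der Corput estimate.\<close>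

lemma ex_finite_inj_on_square:
  assumes "infinite (UNIV :: 'k::field set)"
  shows "\<exists>D. finite D \<and> card D = n \<and> (0::'k) \<notin> D \<and> inj_on (\<lambda>x. x\<^sup>2) D"
proof -
  have "infinite ((\<lambda>x. x\<^sup>2) ` (- {0::'k}))"
  proof
    assume "finite ((\<lambda>x. x\<^sup>2) ` (- {0::'k}))"
    moreover have "infinite (- {0::'k})" using assms by (simp add: Compl_eq_Diff_UNIV)
    ultimately obtain y :: 'k where "infinite {x \<in> - {0}. x\<^sup>2 = y\<^sup>2}"
      using pigeonhole_infinite by blast
    moreover have "{x \<in> - {0}. x\<^sup>2 = y\<^sup>2} \<subseteq> {y, - y}" by (auto simp: power2_eq_iff)
    ultimately show False using finite_subset by blast
  qed
  then obtain E where E: "finite E" "card E = n" "E \<subseteq> (\<lambda>x. x\<^sup>2) ` (- {0::'k})"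
    using infinite_arbitrarily_large by blast
  then obtain D where D: "D \<subseteq> - {0::'k}" "inj_on (\<lambda>x. x\<^sup>2) D" "E = (\<lambda>x. x\<^sup>2) ` D"
    by (auto simp: subset_image_inj)
  with E have "finite D" "card D = n" by (auto simp: finite_image_iff card_image)
  with D show ?thesis by blast
qed

text \<open>Countability of the field makes the affine group countable, so the exceptional null sets
  of all group elements can be united.\<close>

locale affine_action = ergodic_action "affine_group :: ('k::field \<Rightarrow> 'k) monoid" M T
  for M :: "'w measure" and T +
  assumes countable_field: "countable (UNIV :: 'k set)"
begin

definition \<theta> :: "'k \<Rightarrow> 'k \<Rightarrow> 'w \<Rightarrow> 'w" where
  "\<theta> u v = T (affine_map u v)"

lemma \<theta>_comp:
  assumes "a \<noteq> 0" "c \<noteq> 0" "w \<in> space M"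
  shows "\<theta> a b (\<theta> c d w) = \<theta> (a * c) (a * d + b) w"
proof -
  have "affine_map a b \<otimes>\<^bsub>affine_group\<^esub> affine_map c d = affine_map (a * c) (a * d + b)"
    by (simp add: affine_group_def affine_map_def fun_eq_iff algebra_simps)
  then show ?thesis
    using composition_rule[OF assms(3) affine_map_closed affine_map_closed, of a c b d] assms
    by (simp add: \<theta>_def)
qed

lemma \<theta>_id: "w \<in> space M \<Longrightarrow> \<theta> 1 0 w = w"
proof -
  assume w: "w \<in> space M"
  have "affine_map 1 (0::'k) = \<one>\<^bsub>affine_group\<^esub>"
    by (simp add: affine_group_def affine_map_def fun_eq_iff)
  then show ?thesis using fun_cong[OF id_eq_one, of w] w by (simp add: \<theta>_def)
qed

lemma preserves_action:
  assumes "g \<in> carrier affine_group"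
  shows "preserves M (T g)"
  unfolding preserves_def
proof
  show "T g \<in> measurable M M" using assms by (rule measurable_action)
  then show "distr M M (T g) = M"
    by (intro measure_eqI) (simp_all add: emeasure_distr emeasure_vimage_action[OF assms])
qed

lemma preserves_\<theta>: "u \<noteq> 0 \<Longrightarrow> preserves M (\<theta> u v)"
  unfolding \<theta>_def by (intro preserves_action affine_map_closed)

lemma \<theta>_space: "u \<noteq> 0 \<Longrightarrow> w \<in> space M \<Longrightarrow> \<theta> u v w \<in> space M"
  by (rule preserves_space[OF preserves_\<theta>])

text \<open>The inverse of x -> u x + v is x -> x / u - v / u. Forward images thus become preimages,
  whose indicators are compositions with the action.\<close>

lemma \<theta>_image_eq:
  assumes u: "u \<noteq> 0" and A: "A \<subseteq> space M"
  shows "\<theta> u v ` A = {w \<in> space M. \<theta> (1 / u) (- (v / u)) w \<in> A}"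
proof (intro equalityI subsetI)
  fix w assume "w \<in> \<theta> u v ` A"
  then obtain x where x: "x \<in> A" "x \<in> space M" "w = \<theta> u v x" using A by blast
  then show "w \<in> {w \<in> space M. \<theta> (1 / u) (- (v / u)) w \<in> A}"
    using u by (simp add: \<theta>_space \<theta>_comp \<theta>_id)
next
  fix w assume "w \<in> {w \<in> space M. \<theta> (1 / u) (- (v / u)) w \<in> A}"
  then have w: "w \<in> space M" "\<theta> (1 / u) (- (v / u)) w \<in> A" by auto
  moreover have "\<theta> u v (\<theta> (1 / u) (- (v / u)) w) = w"
    using u w by (simp add: \<theta>_comp \<theta>_id)
  ultimately show "w \<in> \<theta> u v ` A" by force
qed

text \<open>The hypothesis \<open>ergodic\<close> concerns strictly invariant sets. The intersection
  \<open>A'\<close> of all preimages of \<open>A\<close> is strictly invariant, and since the group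
  is countable it is measurable and agrees with \<open>A\<close> almost everywhere.\<close>

lemma prob_0_1_of_AE_invariant:
  assumes A: "A \<in> sets M"
    and inv: "\<And>g. g \<in> carrier affine_group \<Longrightarrow> AE w in M. T g w \<in> A \<longleftrightarrow> w \<in> A"
  shows "prob A = 0 \<or> prob A = 1"
proof -
  interpret G: group "affine_group :: ('k \<Rightarrow> 'k) monoid" by (rule group_affine_group)
  let ?G = "carrier (affine_group :: ('k \<Rightarrow> 'k) monoid)"
  have "?G \<subseteq> (\<lambda>(u, v). affine_map u v) ` UNIV" by (auto simp: affine_group_def)
  moreover have "countable (UNIV :: ('k \<times> 'k) set)"
    using countable_SIGMA[of UNIV "\<lambda>_. UNIV"] countable_field by simp
  ultimately have cG: "countable ?G" by (meson countable_image countable_subset)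
  define A' where "A' = (\<Inter>g\<in>?G. T g -` A \<inter> space M)"
  have sets_A': "A' \<in> sets M"
    unfolding A'_def using cG
    by (intro sets.countable_INT') (auto intro: measurable_sets[OF measurable_action A])
  have mem: "w \<in> A' \<longleftrightarrow> w \<in> space M \<and> (\<forall>g\<in>?G. T g w \<in> A)" for w
    using G.one_closed by (auto simp: A'_def)
  have img: "T g w \<in> A'" if g: "g \<in> ?G" and w: "w \<in> A'" for g w
  proof -
    have "T h (T g w) \<in> A" if h: "h \<in> ?G" for h
      using composition_rule[of w h g] G.m_closed[OF h g] w g h by (metis mem)
    then show ?thesis using preserves_space[OF preserves_action[OF g]] w by (simp add: mem)
  qed
  have "T g ` A' = A'" if g: "g \<in> ?G" for g
  proof
    show "T g ` A' \<subseteq> A'" using img g by blast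
    show "A' \<subseteq> T g ` A'"
    proof
      fix w assume w: "w \<in> A'"
      then have ws: "w \<in> space M" by (simp add: mem)
      have "T g (T (inv\<^bsub>affine_group\<^esub> g) w) = w"
        using composition_rule[OF ws g G.inv_closed[OF g]] fun_cong[OF id_eq_one, of w] ws g by simp
      moreover have "T (inv\<^bsub>affine_group\<^esub> g) w \<in> A'" using img w g by simp
      ultimately show "w \<in> T g ` A'" by force
    qed
  qed
  then have "prob A' = 0 \<or> prob A' = 1" using ergodic sets_A' by blast
  moreover have "AE w in M. \<forall>g\<in>?G. T g w \<in> A \<longleftrightarrow> w \<in> A"
    using cG inv by (simp add: AE_ball_countable)
  then have "AE w in M. w \<in> A' \<longleftrightarrow> w \<in> A"
    using AE_space by eventually_elim (use G.one_closed in \<open>auto simp: mem\<close>)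
  then have "prob A' = prob A" using sets_A' A by (intro finite_measure_eq_AE)
  ultimately show ?thesis by simp
qed

text \<open>The set where \<open>k\<close> lies below its mean is invariant almost everywhere, hence
  has measure 0 or 1. Measure 1 would make the mean smaller than itself, so the set is null. The
  factor \<open>s\<close>, taken as 1 and -1, yields both inequalities.\<close>

lemma invariant_AE_const:
  assumes k: "bdd_meas M b k"
    and inv: "\<And>u v. u \<noteq> 0 \<Longrightarrow> AE w in M. k (\<theta> u v w) = k w"
  shows "AE w in M. k w = expectation k"
proof -
  let ?c = "expectation k"
  have [measurable]: "k \<in> borel_measurable M" using k by (rule bdd_meas_measurable)
  have int: "integrable M k" using k by (rule bdd_meas_integrable)
  have inv': "AE w in M. k (T g w) = k w" if "g \<in> carrier affine_group" for g
    using that inv by (auto simp: affine_group_def \<theta>_def)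
  have 01: "prob {w \<in> space M. s * k w < s * ?c} = 0 \<or> prob {w \<in> space M. s * k w < s * ?c} = 1"
    for s :: real
  proof (rule prob_0_1_of_AE_invariant)
    fix g :: "'k \<Rightarrow> 'k" assume g: "g \<in> carrier affine_group"
    show "AE w in M. T g w \<in> {w \<in> space M. s * k w < s * ?c} \<longleftrightarrow> w \<in> {w \<in> space M. s * k w < s * ?c}"
      using inv'[OF g] AE_space
      by eventually_elim (use preserves_space[OF preserves_action[OF g]] in auto)
  qed measurable
  have le: "AE w in M. s * ?c \<le> s * k w" for s :: real
  proof -
    have "prob {w \<in> space M. s * k w < s * ?c} \<noteq> 1"
    proof
      assume "prob {w \<in> space M. s * k w < s * ?c} = 1"
      then have "AE w in M. s * k w < s * ?c"
        using prob_Collect_eq_1[of "\<lambda>w. s * k w < s * ?c"] by simp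
      then have "(\<integral>w. s * k w \<partial>M) < (\<integral>w. s * ?c \<partial>M)"
        using int by (intro expectation_less) (auto simp: prob_space)
      then show False by (simp add: prob_space)
    qed
    then have "prob {w \<in> space M. s * k w < s * ?c} = 0" using 01 by blast
    then have "AE w in M. \<not> s * k w < s * ?c"
      using prob_Collect_eq_0[of "\<lambda>w. s * k w < s * ?c"] by simp
    then show ?thesis by eventually_elim simp
  qed
  show ?thesis using le[of 1] le[of "-1"] by eventually_elim simp
qed

end

text \<open>The sets avoid zero, so that \<open>1 / u\<close> is a genuine inverse for every index.
  A general double Folner sequence is brought into this form by deleting zero.\<close>

locale affine_folner = affine_action M T
  for M :: "'w measure" and T :: "('k::field \<Rightarrow> 'k) \<Rightarrow> 'w \<Rightarrow> 'w" +
  fixes F :: "nat \<Rightarrow> 'k set"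
  assumes inf: "infinite (UNIV :: 'k set)"
    and fin: "finite (F N)" and ne: "F N \<noteq> {}" and zero: "0 \<notin> F N"
    and folner_add: "x \<noteq> 0 \<Longrightarrow> (\<lambda>N. overlap (F N) ((+) x)) \<longlonglongrightarrow> 1"
    and folner_mult: "x \<noteq> 0 \<Longrightarrow> (\<lambda>N. overlap (F N) ((*) x)) \<longlonglongrightarrow> 1"
begin

lemma folner_nonzero: "u \<in> F N \<Longrightarrow> u \<noteq> 0"
  using zero by metis

text \<open>The scale \<open>c\<close> is present because the van der Corput estimate leads to
  translations by \<open>c * u\<close> for many values of \<open>c\<close>. As u -> c u is additive,
  each of them is an action of the additive group, averaged over the same sets.\<close>

lemma folner_system_add:
  assumes c: "c \<noteq> 0"
  shows "folner_system M UNIV (+) (\<lambda>u. \<theta> 1 (c * u)) F"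
proof unfold_locales
  fix x :: 'k
  \<comment> \<open>The Folner hypothesis covers nonzero \<open>x\<close>; for \<open>x = 0\<close>
    the overlap is constantly one.\<close>
  show "(\<lambda>N. overlap (F N) ((+) x)) \<longlonglongrightarrow> 1"
    using folner_add[of x] fin ne by (cases "x = 0") (auto simp: overlap_def)
qed (use preserves_\<theta> in \<open>auto simp: \<theta>_comp fin ne algebra_simps\<close>)

lemma folner_system_mult: "folner_system M (- {0}) (*) (\<lambda>u. \<theta> (1 / u) 0) F"
  by unfold_locales
    (use folner_nonzero in \<open>auto simp: preserves_\<theta> \<theta>_comp fin ne folner_mult inj_on_def\<close>)

text \<open>By the multiplicative Folner property, the average hardly changes when \<open>u\<close>
  is replaced by \<open>d * u\<close> and averaged over \<open>d\<close> in a finite set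
  \<open>D\<close>. Cauchy-Schwarz over \<open>u\<close> then bounds the squared norm by the mean of
  the correlations over all pairs from \<open>D\<close>: the off-diagonal ones vanish in the limit,
  and the diagonal ones carry little weight once \<open>D\<close> is large.\<close>

lemma van_der_Corput:
  assumes \<phi>: "bdd_meas M b \<phi>"
    and lim: "\<And>c. c \<noteq> 0 \<Longrightarrow> (\<lambda>N. \<integral>w. \<bar>average (F N) (\<lambda>u. \<phi> (\<theta> 1 (c * u) w))\<bar> \<partial>M) \<longlonglongrightarrow> 0"
  shows "(\<lambda>N. \<integral>w. \<bar>average (F N) (\<lambda>u. \<phi> (\<theta> (1 / u) u w))\<bar> \<partial>M) \<longlonglongrightarrow> 0"
proof -
  define a where "a u w = \<phi> (\<theta> (1 / u) u w)" for u w
  have a: "bdd_meas M b (a u)" if "u \<noteq> 0" for u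
    unfolding a_def using that by (intro bdd_meas_comp[OF \<phi>] preserves_\<theta>) simp
  define \<kappa> where "\<kappa> N d d' = average (F N) (\<lambda>u. \<integral>w. a (d * u) w * a (d' * u) w \<partial>M)" for N d d'
  have \<kappa>_le: "\<kappa> N d d' \<le> b\<^sup>2" if d: "d \<noteq> 0" "d' \<noteq> 0" for N d d'
  proof -
    have "(\<integral>w. a (d * u) w * a (d' * u) w \<partial>M) \<le> b\<^sup>2" if u: "u \<in> F N" for u
    proof -
      have m: "bdd_meas M (b * b) (\<lambda>w. a (d * u) w * a (d' * u) w)"
        using d folner_nonzero[OF u] by (intro bdd_meas_mult a) auto
      have "(\<integral>w. a (d * u) w * a (d' * u) w \<partial>M) \<le> (\<integral>w. b * b \<partial>M)"
        using abs_le_D1[OF bdd_meas_le[OF m]] by (intro integral_mono bdd_meas_integrable[OF m]) auto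
      then show ?thesis by (simp add: prob_space power2_eq_square)
    qed
    then have "\<kappa> N d d' \<le> average (F N) (\<lambda>_. b\<^sup>2)" unfolding \<kappa>_def by (rule average_mono)
    then show ?thesis by (simp add: fin ne)
  qed
  have \<kappa>_lim: "(\<lambda>N. \<kappa> N d d') \<longlonglongrightarrow> 0" if d: "d \<noteq> 0" "d' \<noteq> 0" "d\<^sup>2 \<noteq> d'\<^sup>2" for d d'
  proof -
    \<comment> \<open>This is d - d'^2 / d, the slope of the translation that remains after the
      substitution below; it is nonzero because the squares differ.\<close>
    define c where "c = (d\<^sup>2 - d'\<^sup>2) / d"
    have c: "c \<noteq> 0" using d by (simp add: c_def)
    define Z where "Z N w = average (F N) (\<lambda>u. \<phi> (\<theta> 1 (c * u) w))" for N w
    have Z: "bdd_meas M b (Z N)" for N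
      unfolding Z_def by (rule bdd_meas_average[OF fin ne bdd_meas_comp[OF \<phi> preserves_\<theta>]]) simp
    have P: "preserves M (\<theta> (1 / d) 0)" "preserves M (\<theta> (1 / d') 0)"
      using d by (auto intro: preserves_\<theta>)
    \<comment> \<open>Substituting \<open>x \<mapsto> u x - d'\<^sup>2 u\<^sup>2\<close> turns the two
      maps \<open>x / (d u) + d u\<close> and \<open>x / (d' u) + d' u\<close> into \<open>x / d + c u\<close> and \<open>x / d'\<close>.\<close>
    have corr: "(\<integral>w. a (d * u) w * a (d' * u) w \<partial>M)
        = (\<integral>w. \<phi> (\<theta> 1 (c * u) (\<theta> (1 / d) 0 w)) * \<phi> (\<theta> (1 / d') 0 w) \<partial>M)"
      if u: "u \<noteq> 0" for u
    proof -
      let ?g = "\<theta> u (- (d'\<^sup>2 * u\<^sup>2))"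
      have m: "(\<lambda>w. a (d * u) w * a (d' * u) w) \<in> borel_measurable M"
        using d u by (intro bdd_meas_measurable[OF bdd_meas_mult[OF a a]]) auto
      have "(\<integral>w. a (d * u) w * a (d' * u) w \<partial>M) = (\<integral>w. a (d * u) (?g w) * a (d' * u) (?g w) \<partial>M)"
        using preserves_integral[OF preserves_\<theta>[OF u] m] by simp
      also have "\<dots> = (\<integral>w. \<phi> (\<theta> 1 (c * u) (\<theta> (1 / d) 0 w)) * \<phi> (\<theta> (1 / d') 0 w) \<partial>M)"
      proof (rule Bochner_Integration.integral_cong[OF refl])
        fix w assume w: "w \<in> space M"
        have "1 / (d * u) * (- (d'\<^sup>2 * u\<^sup>2)) + d * u = c * u"
          using d u by (simp add: c_def field_simps power2_eq_square)
        then have "a (d * u) (?g w) = \<phi> (\<theta> 1 (c * u) (\<theta> (1 / d) 0 w))"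
          using d u w by (simp add: a_def \<theta>_comp)
        moreover have "1 / (d' * u) * (- (d'\<^sup>2 * u\<^sup>2)) + d' * u = 0"
          using d u by (simp add: field_simps power2_eq_square)
        then have "a (d' * u) (?g w) = \<phi> (\<theta> (1 / d') 0 w)"
          using d u w by (simp add: a_def \<theta>_comp)
        ultimately show "a (d * u) (?g w) * a (d' * u) (?g w)
            = \<phi> (\<theta> 1 (c * u) (\<theta> (1 / d) 0 w)) * \<phi> (\<theta> (1 / d') 0 w)" by simp
      qed
      finally show ?thesis .
    qed
    have "\<bar>\<kappa> N d d'\<bar> \<le> b * (\<integral>w. \<bar>Z N w\<bar> \<partial>M)" for N
    proof -
      \<comment> \<open>The second factor no longer depends on \<open>u\<close>, so the average over
        \<open>u\<close> acts on the first factor alone and the L1 norm of \<open>Z N\<close>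
        controls the correlation.\<close>
      have "\<kappa> N d d' = average (F N) (\<lambda>u. \<integral>w. \<phi> (\<theta> 1 (c * u) (\<theta> (1 / d) 0 w)) * \<phi> (\<theta> (1 / d') 0 w) \<partial>M)"
        unfolding \<kappa>_def by (intro average_cong corr folner_nonzero)
      also have "\<dots> = (\<integral>w. average (F N) (\<lambda>u. \<phi> (\<theta> 1 (c * u) (\<theta> (1 / d) 0 w)) * \<phi> (\<theta> (1 / d') 0 w)) \<partial>M)"
        by (rule integral_average[symmetric, OF bdd_meas_mult[OF
              bdd_meas_comp[OF bdd_meas_comp[OF \<phi> preserves_\<theta>] P(1)] bdd_meas_comp[OF \<phi> P(2)]]]) simp
      also have "\<dots> = (\<integral>w. Z N (\<theta> (1 / d) 0 w) * \<phi> (\<theta> (1 / d') 0 w) \<partial>M)"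
        by (simp add: Z_def average_def sum_distrib_right)
      also have "\<bar>\<dots>\<bar> \<le> b * (\<integral>w. \<bar>Z N (\<theta> (1 / d) 0 w)\<bar> \<partial>M)"
        by (rule integral_mult_le_L1[OF bdd_meas_comp[OF Z P(1)] bdd_meas_comp[OF \<phi> P(2)]])
      also have "(\<integral>w. \<bar>Z N (\<theta> (1 / d) 0 w)\<bar> \<partial>M) = (\<integral>w. \<bar>Z N w\<bar> \<partial>M)"
        by (rule preserves_integral[OF P(1) bdd_meas_measurable[OF bdd_meas_abs[OF Z]]])
      finally show ?thesis .
    qed
    moreover have "(\<lambda>N. b * (\<integral>w. \<bar>Z N w\<bar> \<partial>M)) \<longlonglongrightarrow> 0"
      using tendsto_mult_left[OF lim[OF c], of b] by (simp add: Z_def)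
    ultimately show ?thesis
      by (rule tendsto_0_of_abs_le)
  qed
  define Y where "Y N w = average (F N) (\<lambda>u. a u w)" for N w
  have Y: "bdd_meas M b (Y N)" for N
    unfolding Y_def by (rule bdd_meas_average[OF fin ne a[OF folner_nonzero]])
  have "\<forall>\<^sub>F N in sequentially. (\<integral>w. \<bar>Y N w\<bar> \<partial>M) < e" if e: "0 < e" for e
  proof -
    \<comment> \<open>\<open>n\<close> will be the size of \<open>D\<close>. The \<open>n\<close>
      diagonal pairs among all \<open>n * n\<close> pairs contribute \<open>b\<^sup>2 / n\<close> to
      the mean, which must be below the square of \<open>e\<close>.\<close>
    obtain n :: nat where n: "n > 0" "b\<^sup>2 / n < e\<^sup>2"
    proof -
      obtain n :: nat where n: "b\<^sup>2 / e\<^sup>2 < n" using reals_Archimedean2 by blast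
      have "0 \<le> b\<^sup>2 / e\<^sup>2" by simp
      with n have "n > 0" by (simp only: flip: of_nat_0_less_iff[where 'a = real])
      with n show ?thesis using e that by (auto simp: field_simps)
    qed
    obtain D :: "'k set" where D: "finite D" "card D = n" "0 \<notin> D" "inj_on (\<lambda>x. x\<^sup>2) D"
      using ex_finite_inj_on_square[OF inf] by blast
    have Dne: "D \<noteq> {}" using D n by auto
    have Dnz: "d \<noteq> 0" if "d \<in> D" for d using D that by metis
    define W where "W N w = average (F N) (\<lambda>u. average D (\<lambda>d. a (d * u) w))" for N w
    define \<epsilon> where "\<epsilon> N = average D (\<lambda>d. 2 * b * (1 - overlap (F N) ((*) d)))" for N
    \<comment> \<open>On the diagonal the correlation has no reason to decay, so it is replaced by
      its trivial bound.\<close>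
    define R where "R N = average D (\<lambda>d. average D (\<lambda>d'. if d = d' then b\<^sup>2 else \<kappa> N d d'))" for N
    have aD: "bdd_meas M b (\<lambda>w. average D (\<lambda>d. a (d * u) w))" if "u \<in> F N" for u N
      using bdd_meas_average[OF D(1) Dne a, of "\<lambda>d. d * u"] folner_nonzero[OF that] Dnz by auto
    have W: "bdd_meas M b (W N)" for N
      unfolding W_def by (rule bdd_meas_average[OF fin ne aD])
    have YW: "\<bar>Y N w - W N w\<bar> \<le> \<epsilon> N" if w: "w \<in> space M" for N w
    proof -
      have *: "\<bar>average (F N) (\<lambda>u. a (d * u) w) - Y N w\<bar> \<le> 2 * b * (1 - overlap (F N) ((*) d))"
        if d: "d \<in> D" for d
        unfolding Y_def
      proof (rule average_shift[OF fin ne])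
        show "inj_on ((*) d) (F N)" using Dnz[OF d] by (simp add: inj_on_def)
        fix u assume "u \<in> F N \<union> (*) d ` F N"
        then have "u \<noteq> 0" using folner_nonzero Dnz[OF d] by auto
        then show "\<bar>a u w\<bar> \<le> b" using bdd_meas_le[OF a w] by blast
      qed
      have "Y N w - W N w = average D (\<lambda>d. Y N w - average (F N) (\<lambda>u. a (d * u) w))"
        unfolding W_def by (subst average_swap) (simp add: average_diff D Dne)
      also have "\<bar>\<dots>\<bar> \<le> average D (\<lambda>d. \<bar>Y N w - average (F N) (\<lambda>u. a (d * u) w)\<bar>)"
        by (rule average_abs_le)
      also have "\<dots> \<le> \<epsilon> N"
        unfolding \<epsilon>_def by (intro average_mono) (use * in \<open>simp add: abs_minus_commute\<close>)
      finally show ?thesis .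
    qed
    have WR: "(\<integral>w. (W N w)\<^sup>2 \<partial>M) \<le> R N" for N
    proof -
      have prod: "bdd_meas M (b * b) (\<lambda>w. a (d * u) w * a (d' * u) w)"
        if "d \<in> D" "d' \<in> D" "u \<in> F N" for d d' u
        using that folner_nonzero Dnz by (intro bdd_meas_mult a) auto
      have "(\<integral>w. (W N w)\<^sup>2 \<partial>M) \<le> (\<integral>w. average (F N) (\<lambda>u. (average D (\<lambda>d. a (d * u) w))\<^sup>2) \<partial>M)"
        by (rule integral_mono[OF bdd_meas_integrable[OF bdd_meas_power2[OF W]]
              bdd_meas_integrable[OF bdd_meas_average[OF fin ne bdd_meas_power2[OF aD]]]])
          (simp_all add: W_def average_square_le fin)
      also have "\<dots> = (\<integral>w. average (F N) (\<lambda>u. average D (\<lambda>d. average D (\<lambda>d'. a (d * u) w * a (d' * u) w))) \<partial>M)"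
        by (simp only: average_power2)
      also have "\<dots> = average (F N) (\<lambda>u. \<integral>w. average D (\<lambda>d. average D (\<lambda>d'. a (d * u) w * a (d' * u) w)) \<partial>M)"
        by (rule integral_average[OF bdd_meas_average[OF D(1) Dne bdd_meas_average[OF D(1) Dne prod]]])
      also have "\<dots> = average (F N) (\<lambda>u. average D (\<lambda>d. \<integral>w. average D (\<lambda>d'. a (d * u) w * a (d' * u) w) \<partial>M))"
        by (rule average_cong, rule integral_average[OF bdd_meas_average[OF D(1) Dne prod]])
      also have "\<dots> = average (F N) (\<lambda>u. average D (\<lambda>d. average D (\<lambda>d'. \<integral>w. a (d * u) w * a (d' * u) w \<partial>M)))"
        by ((rule average_cong)+, rule integral_average[OF prod])
      also have "\<dots> = average D (\<lambda>d. average D (\<lambda>d'. \<kappa> N d d'))"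
        unfolding \<kappa>_def by (simp only: average_swap[of "F N" D])
      also have "\<dots> \<le> R N"
        unfolding R_def by (intro average_mono) (use \<kappa>_le Dnz in auto)
      finally show ?thesis .
    qed
    have "R \<longlonglongrightarrow> (\<Sum>d\<in>D. (\<Sum>d'\<in>D. if d = d' then b\<^sup>2 else 0) / real (card D)) / real (card D)"
      unfolding R_def average_def
    proof (intro tendsto_divide tendsto_sum tendsto_const)
      fix d d' assume "d \<in> D" "d' \<in> D"
      then show "(\<lambda>N. if d = d' then b\<^sup>2 else \<kappa> N d d') \<longlonglongrightarrow> (if d = d' then b\<^sup>2 else 0)"
        using \<kappa>_lim[of d d'] Dnz inj_onD[OF D(4), of d d'] by auto
    qed (use n D in auto)
    also have "(\<Sum>d\<in>D. (\<Sum>d'\<in>D. if d = d' then b\<^sup>2 else 0) / real (card D)) / real (card D) = b\<^sup>2 / n"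
      using D n by simp
    finally have Rlim: "R \<longlonglongrightarrow> b\<^sup>2 / n" .
    have "\<epsilon> \<longlonglongrightarrow> (\<Sum>d\<in>D. 2 * b * (1 - 1)) / real (card D)"
      unfolding \<epsilon>_def average_def
      by (intro tendsto_intros folner_mult Dnz) (use n D in auto)
    then have "\<epsilon> \<longlonglongrightarrow> 0" by simp
    from tendsto_add[OF this tendsto_real_sqrt[OF Rlim]]
    have "(\<lambda>N. \<epsilon> N + sqrt (R N)) \<longlonglongrightarrow> sqrt (b\<^sup>2 / n)" by simp
    moreover have "sqrt (b\<^sup>2 / n) < e" using n e real_sqrt_less_mono[OF n(2)] by simp
    ultimately have "\<forall>\<^sub>F N in sequentially. \<epsilon> N + sqrt (R N) < e" by (rule order_tendstoD)
    then show ?thesis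
    proof eventually_elim
      case (elim N)
      have "(\<integral>w. \<bar>Y N w - 0\<bar> \<partial>M) \<le> (\<integral>w. \<bar>Y N w - W N w\<bar> \<partial>M) + (\<integral>w. \<bar>W N w - 0\<bar> \<partial>M)"
        by (rule L1_triangle[OF Y W, where c = 0]) (simp add: bdd_meas_def)
      moreover have "(\<integral>w. \<bar>Y N w - W N w\<bar> \<partial>M) \<le> \<epsilon> N"
        by (rule L1_uniform_le[OF Y W YW])
      moreover have "(\<integral>w. \<bar>W N w\<bar> \<partial>M) \<le> sqrt (R N)"
        using L1_square_le[OF W, of N] WR[of N] by (intro real_le_rsqrt) linarith
      ultimately show ?case using elim by simp
    qed
  qed
  then have "(\<lambda>N. \<integral>w. \<bar>Y N w\<bar> \<partial>M) \<longlonglongrightarrow> 0"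
    by (intro order_tendstoI) (auto intro!: always_eventually elim: less_le_trans)
  then show ?thesis by (simp add: Y_def a_def)
qed

end

section \<open>Limits of additive, multiplicative and mixed averages\<close>

context affine_folner
begin

text \<open>One function \<open>h\<close>, obtained at scale 1, has to serve every scale
  \<open>c\<close>. The limit \<open>g\<close> of the averages of \<open>f - h\<close> at scale
  \<open>c\<close> is invariant under all translations, as \<open>c * v\<close> runs through the
  field. So \<open>f\<close> and \<open>h\<close> have equal integrals against \<open>g\<close>, and
  the integral of the square of \<open>g\<close>, being that of \<open>(f - h) * g\<close>, is
  zero.\<close>

lemma additive_limit:
  assumes f: "bdd_meas M b f"
  obtains h where "bdd_meas M b h" "\<And>v. AE w in M. h (\<theta> 1 v w) = h w"
    "expectation h = expectation f"
    "\<And>c. c \<noteq> 0 \<Longrightarrow>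
      (\<lambda>N. \<integral>w. \<bar>average (F N) (\<lambda>u. f (\<theta> 1 (c * u) w) - h (\<theta> 1 (c * u) w))\<bar> \<partial>M) \<longlonglongrightarrow> 0"
proof -
  interpret A: folner_system M UNIV "(+)" "\<lambda>u. \<theta> 1 (1 * u)" F
    by (rule folner_system_add) simp
  obtain h where h: "bdd_meas M b h" and inv: "\<And>v. AE w in M. h (\<theta> 1 (1 * v) w) = h w"
    and eq: "\<And>a q. bdd_meas M a q \<Longrightarrow> (\<And>v. AE w in M. q (\<theta> 1 (1 * v) w) = q w) \<Longrightarrow>
      (\<integral>w. h w * q w \<partial>M) = (\<integral>w. f w * q w \<partial>M)"
    by (rule A.mean_ergodic[OF f]) auto
  have exp: "expectation h = expectation f"
    using eq[of 1 "\<lambda>_. 1"] by (simp add: bdd_meas_def)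
  have "(\<lambda>N. \<integral>w. \<bar>average (F N) (\<lambda>u. f (\<theta> 1 (c * u) w) - h (\<theta> 1 (c * u) w))\<bar> \<partial>M) \<longlonglongrightarrow> 0"
    if c: "c \<noteq> 0" for c
  proof -
    interpret C: folner_system M UNIV "(+)" "\<lambda>u. \<theta> 1 (c * u)" F
      by (rule folner_system_add[OF c])
    have \<phi>: "bdd_meas M (b + b) (\<lambda>w. f w - h w)" by (rule bdd_meas_diff[OF f h])
    obtain g where g: "bdd_meas M (b + b) g"
      and lim: "(\<lambda>N. \<integral>w. \<bar>C.erg (\<lambda>w. f w - h w) N w - g w\<bar> \<partial>M) \<longlonglongrightarrow> 0"
      and ginv: "\<And>v. AE w in M. g (\<theta> 1 (c * v) w) = g w"
      and geq: "\<And>a q. bdd_meas M a q \<Longrightarrow> (\<And>v. AE w in M. q (\<theta> 1 (c * v) w) = q w) \<Longrightarrow>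
        (\<integral>w. g w * q w \<partial>M) = (\<integral>w. (f w - h w) * q w \<partial>M)"
      by (rule C.mean_ergodic[OF \<phi>]) auto
    have ginv1: "AE w in M. g (\<theta> 1 (1 * v) w) = g w" for v
      using ginv[of "v / c"] c by simp
    have "(\<integral>w. g w * g w \<partial>M) = (\<integral>w. (f w - h w) * g w \<partial>M)"
      by (rule geq[OF g ginv])
    also have "\<dots> = (\<integral>w. f w * g w \<partial>M) - (\<integral>w. h w * g w \<partial>M)"
      using bdd_meas_integrable[OF bdd_meas_mult[OF f g]] bdd_meas_integrable[OF bdd_meas_mult[OF h g]]
      by (simp add: left_diff_distrib)
    also have "\<dots> = 0" using eq[OF g ginv1] by simp
    finally have "(\<integral>w. \<bar>g w\<bar> \<partial>M)\<^sup>2 \<le> 0"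
      using L1_square_le[OF g] by (simp add: power2_eq_square)
    then have g0: "(\<integral>w. \<bar>g w\<bar> \<partial>M) = 0" by simp
    have erg: "bdd_meas M (b + b) (C.erg (\<lambda>w. f w - h w) N)" for N
      by (rule C.bdd_meas_erg[OF \<phi>])
    have "(\<integral>w. \<bar>C.erg (\<lambda>w. f w - h w) N w\<bar> \<partial>M)
        \<le> (\<integral>w. \<bar>C.erg (\<lambda>w. f w - h w) N w - g w\<bar> \<partial>M)" for N
    proof -
      have "(\<integral>w. \<bar>C.erg (\<lambda>w. f w - h w) N w - 0\<bar> \<partial>M)
        \<le> (\<integral>w. \<bar>C.erg (\<lambda>w. f w - h w) N w - g w\<bar> \<partial>M) + (\<integral>w. \<bar>g w - 0\<bar> \<partial>M)"
        by (rule L1_triangle[OF erg g, where c = 0]) (simp add: bdd_meas_def)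
      then show ?thesis using g0 by simp
    qed
    then have "(\<lambda>N. \<integral>w. \<bar>C.erg (\<lambda>w. f w - h w) N w\<bar> \<partial>M) \<longlonglongrightarrow> 0"
      by (intro tendsto_0_of_abs_le[OF _ lim]) simp
    then show ?thesis by (simp add: C.erg_def)
  qed
  from that[OF h _ exp this] inv show ?thesis by simp
qed

text \<open>Normality of the translations in concrete form: translating by \<open>v\<close> and then
  dilating by \<open>1 / u\<close> is dilating and then translating by \<open>v / u\<close>, which
  \<open>h\<close> absorbs. Each dilation average of \<open>h\<close> is therefore translation
  invariant almost everywhere, and so is its limit \<open>k\<close>, which is then invariant under
  the whole group and constant by ergodicity.\<close>

lemma multiplicative_limit:
  assumes h: "bdd_meas M b h" and inv: "\<And>v. AE w in M. h (\<theta> 1 v w) = h w"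
  shows "(\<lambda>N. \<integral>w. \<bar>average (F N) (\<lambda>u. h (\<theta> (1 / u) 0 w)) - expectation h\<bar> \<partial>M) \<longlonglongrightarrow> 0"
proof -
  interpret D: folner_system M "- {0}" "(*)" "\<lambda>u. \<theta> (1 / u) 0" F
    by (rule folner_system_mult)
  obtain k where k: "bdd_meas M b k"
    and lim: "(\<lambda>N. \<integral>w. \<bar>D.erg h N w - k w\<bar> \<partial>M) \<longlonglongrightarrow> 0"
    and kinv: "\<And>v. v \<noteq> 0 \<Longrightarrow> AE w in M. k (\<theta> (1 / v) 0 w) = k w"
    and eq: "\<And>a q. bdd_meas M a q \<Longrightarrow> (\<And>v. v \<noteq> 0 \<Longrightarrow> AE w in M. q (\<theta> (1 / v) 0 w) = q w) \<Longrightarrow>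
      (\<integral>w. k w * q w \<partial>M) = (\<integral>w. h w * q w \<partial>M)"
    by (rule D.mean_ergodic[OF h]) auto
  have exp: "expectation k = expectation h"
    using eq[of 1 "\<lambda>_. 1"] by (simp add: bdd_meas_def)
  have add: "AE w in M. k (\<theta> 1 v w) = k w" for v
  proof (rule L1_limit_invariant[OF D.bdd_meas_erg[OF h] k preserves_\<theta> lim _ tendsto_const])
    fix N
    have "AE w in M. \<forall>u\<in>F N. h (\<theta> 1 (v / u) (\<theta> (1 / u) 0 w)) = h (\<theta> (1 / u) 0 w)"
      using fin by (intro AE_finite_allI preserves_AE[OF preserves_\<theta> inv]) (use folner_nonzero in auto)
    then have "AE w in M. \<bar>D.erg h N (\<theta> 1 v w) - D.erg h N w\<bar> = 0"
      using AE_space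
    proof eventually_elim
      case (elim w)
      have "h (\<theta> (1 / u) 0 (\<theta> 1 v w)) = h (\<theta> (1 / u) 0 w)" if "u \<in> F N" for u
        using elim(1)[rule_format, OF that] elim(2) folner_nonzero[OF that] by (simp add: \<theta>_comp)
      then have "D.erg h N (\<theta> 1 v w) = D.erg h N w"
        unfolding D.erg_def by (rule average_cong)
      then show ?case by simp
    qed
    then have "(\<integral>w. \<bar>D.erg h N (\<theta> 1 v w) - D.erg h N w\<bar> \<partial>M) = 0"
      by (intro integral_eq_zero_AE)
    then show "(\<integral>w. \<bar>D.erg h N (\<theta> 1 v w) - D.erg h N w\<bar> \<partial>M) \<le> 0" by simp
  qed simp
  have "AE w in M. k (\<theta> u v w) = k w" if u: "u \<noteq> 0" for u v
  proof -
    have "AE w in M. k (\<theta> u 0 w) = k w" using kinv[of "1 / u"] u by simp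
    with preserves_AE[OF preserves_\<theta>[OF u, of 0] add[of v]] AE_space show ?thesis
      by eventually_elim (simp add: \<theta>_comp u)
  qed
  then have const: "AE w in M. k w = expectation h"
    using invariant_AE_const[OF k] by (simp add: exp)
  have "(\<integral>w. \<bar>D.erg h N w - expectation h\<bar> \<partial>M) = (\<integral>w. \<bar>D.erg h N w - k w\<bar> \<partial>M)" for N
    by (rule integral_cong_AE)
      (use const bdd_meas_measurable[OF D.bdd_meas_erg[OF h]] bdd_meas_measurable[OF k] in auto)
  with lim show ?thesis by (simp add: D.erg_def)
qed

text \<open>The van der Corput estimate disposes of \<open>f - h\<close>. For \<open>h\<close>, the
  map x -> x / u + u is a dilation followed by a translation that \<open>h\<close> ignores almost
  everywhere, simultaneously for the finitely many \<open>u\<close> in \<open>F N\<close>; this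
  leaves the multiplicative averages.\<close>

lemma affine_averages_limit:
  assumes f: "bdd_meas M b f"
  shows "(\<lambda>N. \<integral>w. \<bar>average (F N) (\<lambda>u. f (\<theta> (1 / u) u w)) - expectation f\<bar> \<partial>M) \<longlonglongrightarrow> 0"
proof -
  obtain h where h: "bdd_meas M b h" and inv: "\<And>v. AE w in M. h (\<theta> 1 v w) = h w"
    and exp: "expectation h = expectation f"
    and lim: "\<And>c. c \<noteq> 0 \<Longrightarrow>
      (\<lambda>N. \<integral>w. \<bar>average (F N) (\<lambda>u. f (\<theta> 1 (c * u) w) - h (\<theta> 1 (c * u) w))\<bar> \<partial>M) \<longlonglongrightarrow> 0"
    using additive_limit[OF f] by blast
  define Y where "Y N w = average (F N) (\<lambda>u. f (\<theta> (1 / u) u w) - h (\<theta> (1 / u) u w))" for N w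
  define H where "H N w = average (F N) (\<lambda>u. h (\<theta> (1 / u) 0 w))" for N w
  have p: "preserves M (\<theta> (1 / u) v)" if "u \<in> F N" for u v N
    using folner_nonzero[OF that] by (intro preserves_\<theta>) simp
  have Y: "bdd_meas M (b + b) (Y N)" for N
    unfolding Y_def
    by (rule bdd_meas_average[OF fin ne bdd_meas_diff[OF bdd_meas_comp[OF f p] bdd_meas_comp[OF h p]]])
  have H: "bdd_meas M b (H N)" for N
    unfolding H_def by (rule bdd_meas_average[OF fin ne bdd_meas_comp[OF h p]])
  have const: "bdd_meas M \<bar>expectation f\<bar> (\<lambda>_. expectation f)" by (simp add: bdd_meas_def)
  have Ylim: "(\<lambda>N. \<integral>w. \<bar>Y N w\<bar> \<partial>M) \<longlonglongrightarrow> 0"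
    unfolding Y_def by (rule van_der_Corput[OF bdd_meas_diff[OF f h] lim])
  have Hlim: "(\<lambda>N. \<integral>w. \<bar>H N w - expectation f\<bar> \<partial>M) \<longlonglongrightarrow> 0"
    using multiplicative_limit[OF h inv] by (simp add: H_def exp)
  have le: "(\<integral>w. \<bar>average (F N) (\<lambda>u. f (\<theta> (1 / u) u w)) - expectation f\<bar> \<partial>M)
      \<le> (\<integral>w. \<bar>Y N w\<bar> \<partial>M) + (\<integral>w. \<bar>H N w - expectation f\<bar> \<partial>M)" for N
  proof -
    note Hc = bdd_meas_abs[OF bdd_meas_diff[OF H const]]
    have af: "bdd_meas M b (\<lambda>w. average (F N) (\<lambda>u. f (\<theta> (1 / u) u w)))"
      by (rule bdd_meas_average[OF fin ne bdd_meas_comp[OF f p]])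
    have "AE w in M. \<forall>u\<in>F N. h (\<theta> 1 u (\<theta> (1 / u) 0 w)) = h (\<theta> (1 / u) 0 w)"
      using fin by (intro AE_finite_allI preserves_AE[OF p inv])
    then have "AE w in M. average (F N) (\<lambda>u. f (\<theta> (1 / u) u w)) = Y N w + H N w"
      using AE_space
    proof eventually_elim
      case (elim w)
      have "h (\<theta> (1 / u) u w) = h (\<theta> (1 / u) 0 w)" if "u \<in> F N" for u
        using elim(1)[rule_format, OF that] elim(2) folner_nonzero[OF that] by (simp add: \<theta>_comp)
      then have "H N w = average (F N) (\<lambda>u. h (\<theta> (1 / u) u w))"
        unfolding H_def by (intro average_cong) simp
      then show ?case by (simp add: Y_def average_diff)
    qed
    then have "(\<integral>w. \<bar>average (F N) (\<lambda>u. f (\<theta> (1 / u) u w)) - expectation f\<bar> \<partial>M)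
        \<le> (\<integral>w. \<bar>Y N w\<bar> + \<bar>H N w - expectation f\<bar> \<partial>M)"
      by (intro integral_mono_AE bdd_meas_integrable[OF bdd_meas_abs[OF bdd_meas_diff[OF af const]]]
          Bochner_Integration.integrable_add bdd_meas_integrable[OF bdd_meas_abs[OF Y]]
          bdd_meas_integrable[OF Hc]) (elim eventually_mono, simp)
    also have "\<dots> = (\<integral>w. \<bar>Y N w\<bar> \<partial>M) + (\<integral>w. \<bar>H N w - expectation f\<bar> \<partial>M)"
      by (rule Bochner_Integration.integral_add[OF bdd_meas_integrable[OF bdd_meas_abs[OF Y]]
            bdd_meas_integrable[OF Hc]])
    finally show ?thesis .
  qed
  show ?thesis
    by (rule tendsto_0_of_abs_le[OF _ tendsto_add_zero[OF Ylim Hlim]]) (use le in simp)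
qed

text \<open>A change of variables frees the factor from \<open>C\<close> of \<open>u\<close>. The
  mean of the measures is then the integral of an average of the indicator of \<open>B\<close>
  against one fixed bounded function, and L1 convergence of that average suffices.\<close>

lemma averages_measure_tendsto:
  assumes B: "B \<in> sets M" and C: "C \<in> sets M"
  shows "(\<lambda>N. average (F N) (\<lambda>u. prob (\<theta> 1 (- u) ` B \<inter> \<theta> (1 / u) 0 ` C))) \<longlonglongrightarrow> prob B * prob C"
proof -
  let ?f = "indicator B :: 'w \<Rightarrow> real" and ?g = "indicator C :: 'w \<Rightarrow> real"
  have f: "bdd_meas M 1 ?f" and g: "bdd_meas M 1 ?g"
    using B C by (auto simp: bdd_meas_def indicator_def)
  have Bs: "B \<subseteq> space M" and Cs: "C \<subseteq> space M" using B C sets.sets_into_space by auto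
  have p: "preserves M (\<theta> (1 / u) v)" if "u \<noteq> 0" for u v
    using that by (intro preserves_\<theta>) simp
  have meas: "prob (\<theta> 1 (- u) ` B \<inter> \<theta> (1 / u) 0 ` C) = (\<integral>w. ?f (\<theta> (1 / u) u w) * ?g w \<partial>M)"
    if u: "u \<noteq> 0" for u
  proof -
    let ?k = "\<lambda>w. ?f (\<theta> 1 u w) * ?g (\<theta> u 0 w)"
    have k: "bdd_meas M (1 * 1) ?k"
      by (rule bdd_meas_mult[OF bdd_meas_comp[OF f preserves_\<theta>] bdd_meas_comp[OF g preserves_\<theta>[OF u]]])
        simp
    have "\<theta> 1 (- u) ` B \<inter> \<theta> (1 / u) 0 ` C = {w \<in> space M. ?k w = 1}"
      using u \<theta>_image_eq[OF _ Bs, of 1 "- u"] \<theta>_image_eq[OF _ Cs, of "1 / u" 0]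
      by (auto simp: indicator_def)
    moreover have "(\<integral>w. indicator {w \<in> space M. ?k w = 1} w \<partial>M) = prob {w \<in> space M. ?k w = 1}"
      by (simp add: Int_absorb2)
    moreover have "(\<integral>w. indicator {w \<in> space M. ?k w = 1} w \<partial>M) = (\<integral>w. ?k w \<partial>M)"
      by (intro Bochner_Integration.integral_cong) (auto simp: indicator_def)
    \<comment> \<open>Dilating by \<open>1 / u\<close> cancels the dilation in front of
      \<open>?g\<close> and turns the translation inside \<open>?f\<close> into x -> x / u +
      u.\<close>
    moreover have "(\<integral>w. ?k w \<partial>M) = (\<integral>w. ?k (\<theta> (1 / u) 0 w) \<partial>M)"
      using preserves_integral[OF p[OF u] bdd_meas_measurable[OF k]] by simp
    moreover have "\<dots> = (\<integral>w. ?f (\<theta> (1 / u) u w) * ?g w \<partial>M)"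
      using u by (intro Bochner_Integration.integral_cong) (simp_all add: \<theta>_comp \<theta>_id)
    ultimately show ?thesis by simp
  qed
  let ?X = "\<lambda>N w. average (F N) (\<lambda>u. ?f (\<theta> (1 / u) u w))"
  have X: "bdd_meas M 1 (?X N)" for N
    by (rule bdd_meas_average[OF fin ne bdd_meas_comp[OF f p[OF folner_nonzero]]])
  have const: "bdd_meas M \<bar>prob B\<bar> (\<lambda>_. prob B)" by (simp add: bdd_meas_def)
  have "\<bar>average (F N) (\<lambda>u. prob (\<theta> 1 (- u) ` B \<inter> \<theta> (1 / u) 0 ` C)) - prob B * prob C\<bar>
      \<le> (\<integral>w. \<bar>?X N w - prob B\<bar> \<partial>M)" for N
  proof -
    have "average (F N) (\<lambda>u. prob (\<theta> 1 (- u) ` B \<inter> \<theta> (1 / u) 0 ` C))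
        = average (F N) (\<lambda>u. \<integral>w. ?f (\<theta> (1 / u) u w) * ?g w \<partial>M)"
      by (intro average_cong meas folner_nonzero)
    also have "\<dots> = (\<integral>w. average (F N) (\<lambda>u. ?f (\<theta> (1 / u) u w) * ?g w) \<partial>M)"
      by (rule integral_average[symmetric, OF bdd_meas_mult[OF bdd_meas_comp[OF f p[OF folner_nonzero]] g]])
    also have "\<dots> = (\<integral>w. ?X N w * ?g w \<partial>M)"
      by (simp only: average_def sum_distrib_right times_divide_eq_left)
    finally have "average (F N) (\<lambda>u. prob (\<theta> 1 (- u) ` B \<inter> \<theta> (1 / u) 0 ` C)) - prob B * prob C
        = (\<integral>w. ?X N w * ?g w \<partial>M) - (\<integral>w. prob B * ?g w \<partial>M)"
      using Cs by (simp add: Int_absorb2)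
    also have "\<dots> = (\<integral>w. (?X N w - prob B) * ?g w \<partial>M)"
      unfolding left_diff_distrib
      by (rule Bochner_Integration.integral_diff[symmetric, OF bdd_meas_integrable[OF bdd_meas_mult[OF X g]]
            bdd_meas_integrable[OF bdd_meas_mult[OF const g]]])
    finally show ?thesis using integral_mult_le_L1[OF bdd_meas_diff[OF X const] g, of N] by simp
  qed
  moreover have "(\<lambda>N. \<integral>w. \<bar>?X N w - prob B\<bar> \<partial>M) \<longlonglongrightarrow> 0"
    using affine_averages_limit[OF f] Bs by (simp add: Int_absorb2)
  ultimately have "(\<lambda>N. average (F N) (\<lambda>u. prob (\<theta> 1 (- u) ` B \<inter> \<theta> (1 / u) 0 ` C)) - prob B * prob C) \<longlonglongrightarrow> 0"
    by (rule tendsto_0_of_abs_le)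
  then show ?thesis by (rule LIM_zero_cancel)
qed

end

section \<open>Growth of double Folner sets and removal of zero\<close>

lemma double_folner_overlap:
  assumes "double_folner F" "x \<noteq> 0"
  shows "(\<lambda>N. overlap (F N) ((+) x)) \<longlonglongrightarrow> 1" "(\<lambda>N. overlap (F N) ((*) x)) \<longlonglongrightarrow> 1"
proof -
  have eq: "(+) x = (\<lambda>y. y + x)" by (simp add: fun_eq_iff add.commute)
  show "(\<lambda>N. overlap (F N) ((+) x)) \<longlonglongrightarrow> 1" "(\<lambda>N. overlap (F N) ((*) x)) \<longlonglongrightarrow> 1"
    using assms unfolding double_folner_def overlap_def eq by blast+
qed

text \<open>Suppose \<open>F N\<close> has fewer than \<open>m\<close> elements while its overlap
  exceeds 1 - 1 / (m + 1) for \<open>m\<close> different nonzero shifts. Each shift then loses less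
  than one point, that is, none; so \<open>F N\<close> contains the translates of one of its points
  by all \<open>m\<close> shifts, a contradiction. Growth of the sets makes deleting zero
  harmless.\<close>

lemma double_folner_card_at_top:
  fixes F :: "nat \<Rightarrow> 'k::field set"
  assumes inf: "infinite (UNIV :: 'k set)" and F: "double_folner F"
  shows "filterlim (\<lambda>N. card (F N)) at_top sequentially"
  unfolding filterlim_at_top
proof
  fix m :: nat
  have infX: "infinite (- {0::'k})" using inf by (simp add: Compl_eq_Diff_UNIV)
  obtain X where X: "finite X" "card X = m" "X \<subseteq> - {0::'k}"
    using infinite_arbitrarily_large[OF infX] by blast
  have "\<forall>\<^sub>F N in sequentially. 1 - 1 / real (Suc m) < overlap (F N) ((+) x)" if "x \<in> X" for x
    using X that by (intro order_tendstoD(1)[OF double_folner_overlap(1)[OF F]]) auto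
  then have "\<forall>\<^sub>F N in sequentially. \<forall>x\<in>X. 1 - 1 / real (Suc m) < overlap (F N) ((+) x)"
    using X by (simp add: eventually_ball_finite)
  then show "\<forall>\<^sub>F N in sequentially. m \<le> card (F N)"
  proof eventually_elim
    case (elim N)
    have fin: "finite (F N)" and ne: "F N \<noteq> {}" using F by (auto simp: double_folner_def)
    show ?case
    proof (rule ccontr)
      assume "\<not> m \<le> card (F N)"
      have pos: "0 < card (F N)" using fin ne by (simp add: card_gt_0_iff)
      obtain y where y: "y \<in> F N" using ne by blast
      have "x + y \<in> F N" if x: "x \<in> X" for x
      proof -
        let ?I = "F N \<inter> (+) x ` F N"
        have "(1 - 1 / real (Suc m)) * real (card (F N)) < real (card ?I)"
          using elim x pos by (simp add: overlap_def pos_less_divide_eq)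
        then have "real (card (F N)) - real (card (F N)) / real (Suc m) < real (card ?I)"
          by (simp only: left_diff_distrib mult_1 times_divide_eq_left)
        moreover have "real (card (F N)) / real (Suc m) \<le> 1"
          using \<open>\<not> m \<le> card (F N)\<close> by simp
        ultimately have "real (card (F N)) - 1 < real (card ?I)" by linarith
        then have "card ((+) x ` F N) \<le> card ?I"
          by (simp add: card_image)
        then have "?I = (+) x ` F N" using fin by (intro card_seteq) auto
        then show ?thesis using y by blast
      qed
      then have "(+) y ` X \<subseteq> F N" by (auto simp: add.commute)
      then have "card ((+) y ` X) \<le> card (F N)" using fin by (rule card_mono[rotated])
      then show False using X \<open>\<not> m \<le> card (F N)\<close> by (simp add: card_image)
    qed
  qed
qed

text \<open>Deleting \<open>z\<close> removes at most \<open>z\<close> and \<open>s z\<close> from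
  the intersection, and the denominator does not grow. So the new ratio lies between the old one
  minus 2 / |F N| and 1.\<close>

lemma overlap_remove_tendsto:
  assumes fin: "\<And>N. finite (F N)" and top: "filterlim (\<lambda>N. card (F N)) at_top sequentially"
    and ov: "(\<lambda>N. overlap (F N) s) \<longlonglongrightarrow> 1"
    and F': "\<forall>\<^sub>F N in sequentially. F' N = F N - {z}"
    and ne: "\<And>N. F' N \<noteq> {}"
  shows "(\<lambda>N. overlap (F' N) s) \<longlonglongrightarrow> 1"
proof (rule tendsto_sandwich)
  show "\<forall>\<^sub>F N in sequentially. overlap (F N) s - 2 / real (card (F N)) \<le> overlap (F' N) s"
    using F'
  proof eventually_elim
    case (elim N)
    let ?I = "F N \<inter> s ` F N" and ?J = "F' N \<inter> s ` F' N"
    have "?I - {z, s z} \<subseteq> ?J" using elim by auto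
    then have "card (?I - {z, s z}) \<le> card ?J" using fin elim by (intro card_mono) auto
    moreover have "card ?I - card {z, s z} \<le> card (?I - {z, s z})" by (intro diff_card_le_card_Diff) simp
    moreover have "card {z, s z} \<le> 2" by (simp add: card_insert_if)
    ultimately have "real (card ?I) - 2 \<le> real (card ?J)" by linarith
    then have "overlap (F N) s - 2 / real (card (F N)) \<le> real (card ?J) / real (card (F N))"
      by (simp add: overlap_def diff_divide_distrib[symmetric] divide_right_mono)
    also have "\<dots> \<le> overlap (F' N) s"
    proof -
      have "finite (F' N)" using elim fin by simp
      then have "0 < card (F' N)" using ne by (simp add: card_gt_0_iff)
      moreover have "card (F' N) \<le> card (F N)" using elim fin by (auto intro: card_mono)
      ultimately show ?thesis unfolding overlap_def by (intro divide_left_mono) auto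
    qed
    finally show ?case .
  qed
  show "\<forall>\<^sub>F N in sequentially. overlap (F' N) s \<le> 1"
    using F'
  proof eventually_elim
    case (elim N)
    then have "card (F' N \<inter> s ` F' N) \<le> card (F' N)" using fin by (intro card_mono) auto
    then show ?case by (auto simp: overlap_def divide_le_eq_1)
  qed
  have "(\<lambda>N. 2 / real (card (F N))) \<longlonglongrightarrow> 0"
    by (rule real_tendsto_divide_at_top[OF tendsto_const filterlim_compose[OF filterlim_real_sequentially top]])
  from tendsto_diff[OF ov this] show "(\<lambda>N. overlap (F N) s - 2 / real (card (F N))) \<longlonglongrightarrow> 1" by simp
qed simp

theorem theorem2p7:
  fixes M :: "'w measure"
    and T :: "('k::field \<Rightarrow> 'k) \<Rightarrow> 'w \<Rightarrow> 'w"
    and F :: "nat \<Rightarrow> 'k set"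
    and B C :: "'w set"
  assumes "countable (UNIV :: 'k set)" and "infinite (UNIV :: 'k set)"
    and "ergodic_action affine_group M T"
    and "double_folner F"
    and "B \<in> sets M" and "C \<in> sets M"
  shows "(\<lambda>N. 1 / real (card (F N)) *
            (\<Sum>u\<in>F N - {0}. measure M (shift_set T (- u) B \<inter> dilate_set T (1 / u) C)))
          \<longlonglongrightarrow> measure M B * measure M C"
proof -
  \<comment> \<open>The default \<open>{1}\<close> keeps every set nonempty and free of zero; it
    occurs only finitely often, because the cardinalities tend to infinity.\<close>
  define F' where "F' N = (if F N \<subseteq> {0} then {1} else F N - {0})" for N
  have finF: "finite (F N)" for N using assms(4) by (simp add: double_folner_def)
  have top: "filterlim (\<lambda>N. card (F N)) at_top sequentially"
    by (rule double_folner_card_at_top[OF assms(2,4)])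
  have card2: "\<forall>\<^sub>F N in sequentially. 2 \<le> card (F N)" using top by (simp add: filterlim_at_top)
  have ev: "\<forall>\<^sub>F N in sequentially. F' N = F N - {0}"
    using card2
  proof eventually_elim
    case (elim N)
    then have "\<not> F N \<subseteq> {0}" using card_mono[of "{0::'k}" "F N"] by auto
    then show ?case by (simp add: F'_def)
  qed
  have F'_ne: "F' N \<noteq> {}" for N by (auto simp: F'_def)
  interpret ergodic_action "affine_group :: ('k \<Rightarrow> 'k) monoid" M T by (rule assms(3))
  interpret affine_folner M T F'
  proof unfold_locales
    show "countable (UNIV :: 'k set)" "infinite (UNIV :: 'k set)" by fact+
    show "finite (F' N)" "F' N \<noteq> {}" "0 \<notin> F' N" for N using finF[of N] by (auto simp: F'_def)
  qed (intro overlap_remove_tendsto[OF finF top _ ev F'_ne] double_folner_overlap[OF assms(4)]; assumption)+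
  let ?m = "\<lambda>u. prob (\<theta> 1 (- u) ` B \<inter> \<theta> (1 / u) 0 ` C)"
  \<comment> \<open>The sum in the statement is normalised by the size of \<open>F N\<close>, the
    averages by that of \<open>F' N\<close>; the ratio of the two tends to one.\<close>
  have card_F': "(\<lambda>N. real (card (F' N)) / real (card (F N))) \<longlonglongrightarrow> 1"
  proof (rule tendsto_sandwich)
    show "\<forall>\<^sub>F N in sequentially. 1 - 1 / real (card (F N)) \<le> real (card (F' N)) / real (card (F N))"
      using ev card2
    proof eventually_elim
      case (elim N)
      have "card (F N) - 1 \<le> card (F' N)" using elim diff_card_le_card_Diff[of "{0}" "F N"] by simp
      then have "(real (card (F N)) - 1) / real (card (F N)) \<le> real (card (F' N)) / real (card (F N))"
        by (intro divide_right_mono) auto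
      with elim show ?case by (simp add: diff_divide_distrib)
    qed
    show "\<forall>\<^sub>F N in sequentially. real (card (F' N)) / real (card (F N)) \<le> 1"
      using ev
    proof eventually_elim
      case (elim N)
      have "card (F' N) \<le> card (F N)" unfolding elim by (rule card_mono[OF finF Diff_subset])
      then show ?case by (auto simp: divide_le_eq_1)
    qed
    have "(\<lambda>N. 1 / real (card (F N))) \<longlonglongrightarrow> 0"
      by (rule real_tendsto_divide_at_top[OF tendsto_const filterlim_compose[OF filterlim_real_sequentially top]])
    from tendsto_diff[OF tendsto_const this, of 1]
    show "(\<lambda>N. 1 - 1 / real (card (F N))) \<longlonglongrightarrow> 1" by simp
  qed simp
  have "(\<lambda>N. real (card (F' N)) / real (card (F N)) * average (F' N) ?m) \<longlonglongrightarrow> 1 * (prob B * prob C)"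
    by (rule tendsto_mult[OF card_F' averages_measure_tendsto[OF assms(5,6)]])
  moreover have "\<forall>\<^sub>F N in sequentially. real (card (F' N)) / real (card (F N)) * average (F' N) ?m
      = 1 / real (card (F N)) * (\<Sum>u\<in>F N - {0}. prob (shift_set T (- u) B \<inter> dilate_set T (1 / u) C))"
    using ev
  proof eventually_elim
    case (elim N)
    have "card (F' N) \<noteq> 0" using F'_ne fin by simp
    then show ?case
      by (simp add: average_def shift_set_def dilate_set_def \<theta>_def flip: elim)
  qed
  ultimately show ?thesis unfolding mult_1 by (rule Lim_transform_eventually)
qed

end
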